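(* Let $X$ and $Y$ be two real Banach spaces, let $n\in\mathbb N$ and let $x_1,\ldots,x_n\in S_X$, $y_1,\ldots,y_n\in S_Y$ be such that $\frac1n\left\|\sum_{i=1}^n x_i\otimes y_i\right\|=1$ in $X\widehat{\otimes}_\pi Y$ (this condition is equivalent to the existence of a norm-one bilinear mapping $V\in\mathcal B(X\times Y)$ such that $V(x_i,y_i)=1$ for every $1\leq i\leq n$). The following are equivalent: (1) For every $\lambda_1,\ldots,\lambda_n\in(0,1]$ such that $\sum_{i=1}^n\lambda_i=1$, the element $\sum_{i=1}^n\lambda_i x_i\otimes y_i$ is an SSD point of $S_{X\widehat{\otimes}_\pi Y}$. (2) For every $\varepsilon>0$ there exists $\eta>0$ (depending on $\varepsilon$ and on the points $x_1,\ldots,x_n,y_1,\ldots,y_n$) satisfying the following condition: if $B\in\mathcal B(X\times Y)$ satisfies $\|B\|\leq 1$ and $B(x_i,y_i)>1-\eta$ for every $1\leq i\leq n$, then there exists $\tilde B\in\mathcal B(X\times Y)$ with $\|\tilde B\|=1$ such that $\tilde B(x_i,y_i)=1$ for every $1\leq i\leq n$ and $\|B-\tilde B\|<\varepsilon$.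
   Context: All Banach spaces are real. $B_X$ and $S_X$ denote the closed unit ball and unit sphere of $X$. $\mathcal B(X\times Y)$ is the Banach space of bounded bilinear maps $X\times Y\to\mathbb R$ with norm $\|B\|=\sup\{|B(x,y)|:x\in B_X,y\in B_Y\}$. SSD point: $x\in S_X$ is an SSD point (the norm of $X$ is strongly subdifferentiable at $x$) if the one-sided limit $\lim_{t\to 0^+}\frac{\|x+th\|-1}{t}$ exists uniformly in $h\in S_X$. Projective tensor product: $X\widehat{\otimes}_\pi Y$ is the completion of the algebraic tensor product $X\otimes Y$ under the norm $\|z\|_\pi=\inf\{\sum_{n=1}^k\|x_n\|\|y_n\|: z=\sum_{n=1}^k x_n\otimes y_n\}$. Its dual is isometrically identified with $\mathcal B(X\times Y)$ via $B(x\otimes y)=B(x,y)$. *)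

theory Defs
  imports "HOL-Analysis.Analysis" "HOL-Analysis.Finite_Function_Topology"
begin

text \<open>
  The projective norm is separating only because bounded linear functionals separate points, so the
  normed-space instance for the algebraic tensor product below rests on the Hahn--Banach theorem. It
  is proved here by taking a minimal sublinear functional, which is necessarily linear.
\<close>

definition sublinear :: "('a::real_vector \<Rightarrow> real) \<Rightarrow> bool" where
  "sublinear p \<longleftrightarrow> (\<forall>x y. p (x + y) \<le> p x + p y) \<and> (\<forall>r x. 0 \<le> r \<longrightarrow> p (r *\<^sub>R x) \<le> r * p x)"

lemma sublinear_add: "sublinear p \<Longrightarrow> p (x + y) \<le> p x + p y"
  and sublinear_scale_le: "sublinear p \<Longrightarrow> 0 \<le> r \<Longrightarrow> p (r *\<^sub>R x) \<le> r * p x"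
  by (auto simp: sublinear_def)

lemma sublinear_zero: "sublinear p \<Longrightarrow> p 0 = 0"
  using sublinear_add[of p 0 0] sublinear_scale_le[of p 0 0] by simp

lemma sublinear_minus: "sublinear p \<Longrightarrow> - p (- x) \<le> p x"
  using sublinear_add[of p x "- x"] sublinear_zero[of p] by simp

lemma sublinear_scale:
  assumes "sublinear p" "0 \<le> r" shows "p (r *\<^sub>R x) = r * p x"
proof (cases "r = 0")
  case False
  then have "p ((1/r) *\<^sub>R (r *\<^sub>R x)) \<le> (1/r) * p (r *\<^sub>R x)"
    using assms by (intro sublinear_scale_le) auto
  then have "r * p x \<le> p (r *\<^sub>R x)"
    using False assms(2) by (simp add: field_simps)
  then show ?thesis
    using sublinear_scale_le[OF assms, of x] by linarith
qed (use assms in \<open>simp add: sublinear_zero\<close>)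

lemma sublinear_chain_Inf:
  assumes p0: "sublinear p0" and ne: "C \<noteq> {}"
    and C: "\<And>p. p \<in> C \<Longrightarrow> sublinear p \<and> p \<le> p0"
    and chain: "\<And>p q. p \<in> C \<Longrightarrow> q \<in> C \<Longrightarrow> p \<le> q \<or> q \<le> p"
  defines "u \<equiv> \<lambda>x. INF p\<in>C. p x"
  shows "sublinear u \<and> (\<forall>p\<in>C. u \<le> p)"
proof -
  have bdd: "bdd_below ((\<lambda>p. p x) ` C)" for x
  proof (rule bdd_belowI2)
    fix p assume p: "p \<in> C"
    have "- p (- x) \<le> p x" using p C sublinear_minus by blast
    moreover have "p (- x) \<le> p0 (- x)" using p C by (auto simp: le_fun_def)
    ultimately show "- p0 (- x) \<le> p x" by linarith
  qed
  have le: "u x \<le> p x" if "p \<in> C" for p x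
    unfolding u_def by (rule cINF_lower[OF bdd that])
  have ge: "c \<le> u x" if "\<And>p. p \<in> C \<Longrightarrow> c \<le> p x" for c x
    unfolding u_def by (rule cINF_greatest[OF ne]) (use that in auto)
  have "u (x + y) \<le> u x + u y" for x y
  proof -
    have *: "u (x + y) \<le> p x + q y" if pq: "p \<in> C" "q \<in> C" for p q
      using chain[OF pq]
    proof
      assume "p \<le> q"
      then have "p y \<le> q y" by (simp add: le_fun_def)
      then show ?thesis
        using le[OF pq(1), of "x + y"] sublinear_add[of p x y] C[OF pq(1)] by linarith
    next
      assume "q \<le> p"
      then have "q x \<le> p x" by (simp add: le_fun_def)
      then show ?thesis
        using le[OF pq(2), of "x + y"] sublinear_add[of q x y] C[OF pq(2)] by linarith
    qed
    have "u (x + y) - q y \<le> u x" if "q \<in> C" for q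
      by (rule ge) (use *[OF _ that] in \<open>simp add: algebra_simps\<close>)
    then have "u (x + y) - u x \<le> u y"
      by (intro ge) (simp add: algebra_simps)
    then show ?thesis by simp
  qed
  moreover have "u (r *\<^sub>R x) \<le> r * u x" if "0 \<le> r" for r x
  proof (cases "r = 0")
    case True
    obtain p where "p \<in> C" using ne by auto
    then show ?thesis using le[of p 0] C[of p] sublinear_zero[of p] True by simp
  next
    case False
    then have r: "r > 0" using that by simp
    have "u (r *\<^sub>R x) / r \<le> u x"
    proof (rule ge)
      fix p assume "p \<in> C"
      then have "u (r *\<^sub>R x) \<le> r * p x"
        using le[of p "r *\<^sub>R x"] sublinear_scale[of p r x] C[of p] that by auto
      then show "u (r *\<^sub>R x) / r \<le> p x" using r by (simp add: field_simps)
    qed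
    then show ?thesis using r by (simp add: field_simps)
  qed
  ultimately show ?thesis using le by (auto simp: sublinear_def le_fun_def)
qed

lemma sublinear_drop:
  assumes p: "sublinear p"
  shows "\<exists>q. sublinear q \<and> q \<le> p \<and> q (- y) \<le> - p y"
proof -
  define q where "q = (\<lambda>x. INF t\<in>{0..}. p (x + t *\<^sub>R y) - t * p y)"
  have bdd: "bdd_below ((\<lambda>t. p (x + t *\<^sub>R y) - t * p y) ` {0..})" for x
  proof (rule bdd_belowI2)
    fix t :: real assume "t \<in> {0..}"
    then have "t * p y = p (t *\<^sub>R y)" using sublinear_scale[OF p] by simp
    also have "\<dots> \<le> p (x + t *\<^sub>R y) + p (- x)"
      using sublinear_add[OF p, of "x + t *\<^sub>R y" "- x"] by simp
    finally show "- p (- x) \<le> p (x + t *\<^sub>R y) - t * p y" by simp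
  qed
  have le: "q x \<le> p (x + t *\<^sub>R y) - t * p y" if "0 \<le> t" for x t
    unfolding q_def by (rule cINF_lower[OF bdd]) (use that in auto)
  have ge: "c \<le> q x" if "\<And>t. 0 \<le> t \<Longrightarrow> c \<le> p (x + t *\<^sub>R y) - t * p y" for c x
    unfolding q_def by (rule cINF_greatest) (use that in auto)
  have "q (x + x') \<le> q x + q x'" for x x'
  proof -
    have *: "q (x + x') \<le> (p (x + t *\<^sub>R y) - t * p y) + (p (x' + t' *\<^sub>R y) - t' * p y)"
      if "0 \<le> t" "0 \<le> t'" for t t'
    proof -
      have "q (x + x') \<le> p (x + x' + (t + t') *\<^sub>R y) - (t + t') * p y"
        by (rule le) (use that in auto)
      moreover have "x + x' + (t + t') *\<^sub>R y = (x + t *\<^sub>R y) + (x' + t' *\<^sub>R y)"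
        by (simp add: algebra_simps)
      ultimately show ?thesis
        using sublinear_add[OF p, of "x + t *\<^sub>R y" "x' + t' *\<^sub>R y"] by (simp add: algebra_simps)
    qed
    have "q (x + x') - (p (x' + t' *\<^sub>R y) - t' * p y) \<le> q x" if "0 \<le> t'" for t'
      by (rule ge) (use *[OF _ that] in \<open>simp add: algebra_simps\<close>)
    then have "q (x + x') - q x \<le> q x'"
      by (intro ge) (simp add: algebra_simps)
    then show ?thesis by simp
  qed
  moreover have "q (r *\<^sub>R x) \<le> r * q x" if "0 \<le> r" for r x
  proof (cases "r = 0")
    case True
    then show ?thesis using le[of 0 0] sublinear_zero[OF p] by simp
  next
    case False
    then have r: "r > 0" using that by simp
    have "q (r *\<^sub>R x) / r \<le> q x"
    proof (rule ge)
      fix t :: real assume t: "0 \<le> t"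
      have "q (r *\<^sub>R x) \<le> p (r *\<^sub>R x + (r * t) *\<^sub>R y) - (r * t) * p y"
        by (rule le) (use t r in auto)
      also have "r *\<^sub>R x + (r * t) *\<^sub>R y = r *\<^sub>R (x + t *\<^sub>R y)"
        by (simp add: algebra_simps)
      also have "p \<dots> = r * p (x + t *\<^sub>R y)"
        by (rule sublinear_scale[OF p that])
      finally show "q (r *\<^sub>R x) / r \<le> p (x + t *\<^sub>R y) - t * p y"
        using r by (simp add: field_simps)
    qed
    then show ?thesis using r by (simp add: field_simps)
  qed
  moreover have "q x \<le> p x" for x using le[of 0 x] by simp
  moreover have "q (- y) \<le> - p y" using le[of 1 "- y"] sublinear_zero[OF p] by simp
  ultimately show ?thesis by (auto simp: sublinear_def le_fun_def intro!: exI[of _ q])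
qed

lemma hahn_banach_sublinear:
  assumes p0: "sublinear p0"
  shows "\<exists>f. linear f \<and> f \<le> p0"
proof -
  define A where "A = {p. sublinear p \<and> p \<le> p0}"
  define P :: "('a \<Rightarrow> real) \<Rightarrow> ('a \<Rightarrow> real) \<Rightarrow> bool" where "P = (\<lambda>a u. u \<le> a)"
  have po: "partial_order_on A (relation_of P A)"
    by (rule partial_order_on_relation_ofI) (auto simp: P_def)
  have "\<exists>m\<in>A. \<forall>a\<in>A. P m a \<longrightarrow> a = m"
  proof (rule predicate_Zorn[OF po])
    fix C assume C: "C \<in> Chains (relation_of P A)"
    show "\<exists>u\<in>A. \<forall>a\<in>C. P a u"
    proof (cases "C = {}")
      case True
      then show ?thesis using p0 by (auto simp: A_def)
    next
      case False
      have CA: "p \<in> A" if "p \<in> C" for p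
        using C that by (auto simp: Chains_def relation_of_def)
      have ch: "p \<le> q \<or> q \<le> p" if "p \<in> C" "q \<in> C" for p q
        using C that by (auto simp: Chains_def relation_of_def P_def)
      obtain u where u: "sublinear u" "\<forall>p\<in>C. u \<le> p"
        using sublinear_chain_Inf[OF p0 False] CA ch unfolding A_def by blast
      obtain p where "p \<in> C" using False by auto
      then have "u \<le> p0" using u(2) CA order_trans unfolding A_def by blast
      then show ?thesis using u by (auto simp: A_def P_def)
    qed
  qed
  then obtain m where m: "sublinear m" "m \<le> p0"
    and min: "\<And>q. sublinear q \<Longrightarrow> q \<le> m \<Longrightarrow> q = m"
    unfolding A_def P_def by (blast intro: order_trans)
  have neg: "m (- y) = - m y" for y
  proof -
    obtain q where q: "sublinear q" "q \<le> m" "q (- y) \<le> - m y"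
      using sublinear_drop[OF m(1)] by blast
    then have "m (- y) \<le> - m y" using min by blast
    then show ?thesis using sublinear_minus[OF m(1), of y] by linarith
  qed
  have "m (x + y) = m x + m y" for x y
    using sublinear_add[OF m(1), of x y] sublinear_add[OF m(1), of "- x" "- y"]
      neg[of x] neg[of y] neg[of "x + y"] by simp
  moreover have "m (r *\<^sub>R x) = r *\<^sub>R m x" for r x
  proof (cases "0 \<le> r")
    case False
    then have "m ((- r) *\<^sub>R x) = (- r) * m x" by (intro sublinear_scale[OF m(1)]) simp
    then show ?thesis using neg[of "r *\<^sub>R x"] by simp
  qed (use sublinear_scale[OF m(1)] in simp)
  ultimately show ?thesis using m(2) by (blast intro: linearI)
qed

lemma norming_functional:
  fixes x0 :: "'a::real_normed_vector"
  shows "\<exists>f. bounded_linear f \<and> (\<forall>x. \<bar>f x\<bar> \<le> norm x) \<and> f x0 = norm x0"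
proof -
  have "sublinear (norm :: 'a \<Rightarrow> real)"
    by (auto simp: sublinear_def norm_triangle_ineq)
  from sublinear_drop[OF this, of x0]
  obtain q :: "'a \<Rightarrow> real" where q: "sublinear q" "q \<le> norm" "q (- x0) \<le> - norm x0" by blast
  obtain f where f: "linear f" "f \<le> q" using hahn_banach_sublinear[OF q(1)] by blast
  have le: "f x \<le> norm x" for x
    using f(2) q(2) order_trans by (metis le_funD)
  have abs: "\<bar>f x\<bar> \<le> norm x" for x
    using le[of x] le[of "- x"] linear_neg[OF f(1), of x] by (simp add: abs_le_iff)
  have "f (- x0) \<le> - norm x0" using f(2) q(3) order_trans by (metis le_funD)
  then have "f x0 = norm x0" using le[of x0] linear_neg[OF f(1), of x0] by simp
  moreover have "bounded_linear f"
    using f(1) abs by (auto simp: bounded_linear_def bounded_linear_axioms_def intro!: exI[of _ 1])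
  ultimately show ?thesis using abs by blast
qed

text \<open>
  The algebraic tensor product is the free real vector space on pairs modulo the span of the
  bilinearity relations.
\<close>

definition tensor_relations ::
    "(('a::real_vector \<times> 'b::real_vector) \<Rightarrow>\<^sub>0 real) set" where
  "tensor_relations =
     {Poly_Mapping.single (x + x', y) 1 - Poly_Mapping.single (x, y) 1 - Poly_Mapping.single (x', y) 1
        | x x' y. True} \<union>
     {Poly_Mapping.single (x, y + y') 1 - Poly_Mapping.single (x, y) 1 - Poly_Mapping.single (x, y') 1
        | x y y'. True} \<union>
     {Poly_Mapping.single (r *\<^sub>R x, y) 1 - r *\<^sub>R Poly_Mapping.single (x, y) 1 | r x y. True} \<union>
     {Poly_Mapping.single (x, r *\<^sub>R y) 1 - r *\<^sub>R Poly_Mapping.single (x, y) 1 | r x y. True}"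

definition tensor_rel ::
    "(('a::real_vector \<times> 'b::real_vector) \<Rightarrow>\<^sub>0 real) \<Rightarrow> (('a \<times> 'b) \<Rightarrow>\<^sub>0 real) \<Rightarrow> bool" where
  "tensor_rel p q \<longleftrightarrow> p - q \<in> span tensor_relations"

lemma equivp_tensor_rel:
  "equivp (tensor_rel :: (('a::real_vector \<times> 'b::real_vector) \<Rightarrow>\<^sub>0 real) \<Rightarrow> _)"
proof (rule equivpI)
  show "reflp (tensor_rel :: (('a \<times> 'b) \<Rightarrow>\<^sub>0 real) \<Rightarrow> _)" by (auto simp: reflp_def tensor_rel_def span_zero)
  show "symp (tensor_rel :: (('a \<times> 'b) \<Rightarrow>\<^sub>0 real) \<Rightarrow> _)"
  proof (rule sympI)
    fix p q :: "('a \<times> 'b) \<Rightarrow>\<^sub>0 real" assume "tensor_rel p q"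
    from span_neg[OF this[unfolded tensor_rel_def]] show "tensor_rel q p" by (simp add: tensor_rel_def)
  qed
  show "transp (tensor_rel :: (('a \<times> 'b) \<Rightarrow>\<^sub>0 real) \<Rightarrow> _)"
  proof (rule transpI)
    fix p q r :: "('a \<times> 'b) \<Rightarrow>\<^sub>0 real" assume "tensor_rel p q" "tensor_rel q r"
    from span_add[OF this[unfolded tensor_rel_def]] show "tensor_rel p r" by (simp add: tensor_rel_def)
  qed
qed

quotient_type (overloaded) ('a, 'b) tensor =
    "('a::real_vector \<times> 'b::real_vector) \<Rightarrow>\<^sub>0 real" / tensor_rel
  by (rule equivp_tensor_rel)

instantiation tensor :: (real_vector, real_vector) real_vector
begin

lift_definition zero_tensor :: "('a, 'b) tensor" is 0 .

lift_definition plus_tensor :: "('a, 'b) tensor \<Rightarrow> ('a, 'b) tensor \<Rightarrow> ('a, 'b) tensor" is "(+)"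
  by (simp only: tensor_rel_def add_diff_add span_add)

lift_definition uminus_tensor :: "('a, 'b) tensor \<Rightarrow> ('a, 'b) tensor" is uminus
  by (simp only: tensor_rel_def minus_diff_minus span_neg)

lift_definition minus_tensor :: "('a, 'b) tensor \<Rightarrow> ('a, 'b) tensor \<Rightarrow> ('a, 'b) tensor" is "(-)"
proof -
  fix p p' q q' :: "('a \<times> 'b) \<Rightarrow>\<^sub>0 real"
  assume "tensor_rel p p'" "tensor_rel q q'"
  from span_diff[OF this[unfolded tensor_rel_def]]
  have "(p - p') - (q - q') \<in> span tensor_relations" .
  moreover have "(p - p') - (q - q') = p - q - (p' - q')" by (simp add: algebra_simps)
  ultimately show "tensor_rel (p - q) (p' - q')" by (simp only: tensor_rel_def)
qed

lift_definition scaleR_tensor :: "real \<Rightarrow> ('a, 'b) tensor \<Rightarrow> ('a, 'b) tensor" is scaleR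
  by (simp only: tensor_rel_def scaleR_diff_right[symmetric] span_scale)

instance
proof
  fix z w u :: "('a, 'b) tensor" and r s :: real
  show "z + w + u = z + (w + u)" by transfer (simp add: tensor_rel_def add.assoc span_zero)
  show "z + w = w + z" by transfer (simp add: tensor_rel_def add.commute span_zero)
  show "0 + z = z" by transfer (simp add: tensor_rel_def span_zero)
  show "- z + z = 0" by transfer (simp add: tensor_rel_def span_zero)
  show "z - w = z + - w" by transfer (simp add: tensor_rel_def span_zero)
  show "r *\<^sub>R (z + w) = r *\<^sub>R z + r *\<^sub>R w"
    by transfer (simp add: tensor_rel_def scaleR_add_right span_zero)
  show "(r + s) *\<^sub>R z = r *\<^sub>R z + s *\<^sub>R z"
    by transfer (simp add: tensor_rel_def scaleR_add_left span_zero)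
  show "r *\<^sub>R s *\<^sub>R z = (r * s) *\<^sub>R z" by transfer (simp add: tensor_rel_def span_zero)
  show "1 *\<^sub>R z = z" by transfer (simp add: tensor_rel_def span_zero)
qed

end

lift_definition tensor_of :: "'a::real_vector \<Rightarrow> 'b::real_vector \<Rightarrow> ('a, 'b) tensor"
  is "\<lambda>x y. Poly_Mapping.single (x, y) 1" .

lemma bilinear_tensor_of: "bilinear tensor_of"
proof -
  have "tensor_of (x + x') y = tensor_of x y + tensor_of x' y" for x x' :: 'a and y :: 'b
    by transfer (unfold tensor_rel_def diff_diff_eq[symmetric], rule span_base, unfold tensor_relations_def, blast)
  moreover have "tensor_of x (y + y') = tensor_of x y + tensor_of x y'" for x :: 'a and y y' :: 'b
    by transfer (unfold tensor_rel_def diff_diff_eq[symmetric], rule span_base, unfold tensor_relations_def, blast)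
  moreover have "tensor_of (r *\<^sub>R x) y = r *\<^sub>R tensor_of x y" for r and x :: 'a and y :: 'b
    by transfer (unfold tensor_rel_def, rule span_base, unfold tensor_relations_def, blast)
  moreover have "tensor_of x (r *\<^sub>R y) = r *\<^sub>R tensor_of x y" for r and x :: 'a and y :: 'b
    by transfer (unfold tensor_rel_def, rule span_base, unfold tensor_relations_def, blast)
  ultimately show ?thesis by (auto simp: bilinear_def intro!: linearI)
qed

lemma lookup_scaleR_real: "poly_mapping.lookup (r *\<^sub>R p) k = r * poly_mapping.lookup p (k::'k) " for p :: "'k \<Rightarrow>\<^sub>0 real"
proof -
  have "finite {x. r *\<^sub>R poly_mapping.lookup p x \<noteq> 0}"
    by (rule finite_subset[OF _ finite_lookup[of p]]) auto
  then show ?thesis by (simp add: scaleR_poly_mapping_def lookup_Abs_poly_mapping)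
qed

lemma free_linear_extension:
  fixes g :: "'k \<Rightarrow> 'c::real_vector"
  defines "L \<equiv> \<lambda>p::'k \<Rightarrow>\<^sub>0 real. \<Sum>k\<in>Poly_Mapping.keys p. poly_mapping.lookup p k *\<^sub>R g k"
  shows "linear L" "L (Poly_Mapping.single k 1) = g k"
proof -
  show "linear L"
  proof (rule linearI)
    fix p q :: "'k \<Rightarrow>\<^sub>0 real"
    show "L (p + q) = L p + L q"
      unfolding L_def by (rule setsum_keys_plus_distrib) (auto simp: algebra_simps)
  next
    fix r and p :: "'k \<Rightarrow>\<^sub>0 real"
    have "L (r *\<^sub>R p) = (\<Sum>k\<in>Poly_Mapping.keys p. poly_mapping.lookup (r *\<^sub>R p) k *\<^sub>R g k)"
      unfolding L_def
      by (rule sum.mono_neutral_left) (auto simp: in_keys_iff lookup_scaleR_real)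
    then show "L (r *\<^sub>R p) = r *\<^sub>R L p"
      by (simp add: L_def scaleR_sum_right lookup_scaleR_real)
  qed
  show "L (Poly_Mapping.single k 1) = g k" by (simp add: L_def)
qed

lemma tensor_universal:
  fixes f :: "'a::real_vector \<Rightarrow> 'b::real_vector \<Rightarrow> 'c::real_vector"
  assumes f: "bilinear f"
  shows "\<exists>L. linear L \<and> (\<forall>x y. L (tensor_of x y) = f x y)"
proof -
  define M where "M = (\<lambda>p::('a \<times> 'b) \<Rightarrow>\<^sub>0 real.
    \<Sum>k\<in>Poly_Mapping.keys p. poly_mapping.lookup p k *\<^sub>R f (fst k) (snd k))"
  have M: "linear M" "M (Poly_Mapping.single (x, y) 1) = f x y" for x y
    unfolding M_def using free_linear_extension[of "\<lambda>k. f (fst k) (snd k)"] by auto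
  have rel: "M p = 0" if "p \<in> tensor_relations" for p
    using that unfolding tensor_relations_def
    by (auto simp: linear_diff[OF M(1)] linear_scale[OF M(1)] M(2)
        bilinear_ladd[OF f] bilinear_radd[OF f] bilinear_lmul[OF f] bilinear_rmul[OF f])
  have "M p = M q" if "tensor_rel p q" for p q
  proof -
    have "M (p - q) = 0"
      using that rel linear_eq_0_on_span[OF M(1)] unfolding tensor_rel_def by blast
    then show ?thesis by (simp add: linear_diff[OF M(1)])
  qed
  note resp = this
  define L where "L = (\<lambda>z. M (rep_tensor z))"
  have L: "L (abs_tensor p) = M p" for p
    unfolding L_def by (rule resp, rule Quotient_rep_abs[OF Quotient_tensor],
        rule equivp_reflp[OF equivp_tensor_rel])
  have "linear L"
  proof (rule linearI)
    show "L (z + w) = L z + L w" for z w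
      by (induction z; induction w)
        (metis L plus_tensor.abs_eq linear_add[OF M(1)] )
    show "L (r *\<^sub>R z) = r *\<^sub>R L z" for r z
      by (induction z) (metis L scaleR_tensor.abs_eq linear_scale[OF M(1)])
  qed
  moreover have "L (tensor_of x y) = f x y" for x y
    by (simp add: tensor_of.abs_eq L M(2))
  ultimately show ?thesis by blast
qed

lemma sum_lessThan_append:
  fixes f g :: "nat \<Rightarrow> 'c::comm_monoid_add"
  shows "(\<Sum>i<k + l. if i < k then f i else g (i - k)) = (\<Sum>i<k. f i) + (\<Sum>i<l. g i)"
proof (induction l)
  case (Suc l)
  then show ?case by (simp add: add.assoc)
qed (auto intro: sum.cong)

lemma tensor_sum_exists:
  fixes z :: "('a::real_vector, 'b::real_vector) tensor"
  shows "\<exists>k x y. z = (\<Sum>i<(k::nat). tensor_of (x i) (y i))"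
proof -
  let ?P = "\<lambda>z::('a, 'b) tensor. \<exists>k x y. z = (\<Sum>i<(k::nat). tensor_of (x i) (y i))"
  have zero: "?P 0" by (rule exI[of _ 0]) simp
  have add: "?P (z + w)" if zw: "?P z" "?P w" for z w
  proof -
    obtain k x y where z: "z = (\<Sum>i<(k::nat). tensor_of (x i) (y i))" using zw by blast
    obtain l u v where w: "w = (\<Sum>i<(l::nat). tensor_of (u i) (v i))" using zw by blast
    have "z + w = (\<Sum>i<k + l. if i < k then tensor_of (x i) (y i) else tensor_of (u (i - k)) (v (i - k)))"
      unfolding z w by (rule sum_lessThan_append[symmetric])
    also have "\<dots> = (\<Sum>i<k + l. tensor_of (if i < k then x i else u (i - k)) (if i < k then y i else v (i - k)))"
      by (rule sum.cong) auto
    finally show ?thesis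
      by (intro exI[of _ "k + l"] exI[of _ "\<lambda>i. if i < k then x i else u (i - k)"]
          exI[of _ "\<lambda>i. if i < k then y i else v (i - k)"])
  qed
  have one: "?P (r *\<^sub>R tensor_of a b)" for r a b
    by (rule exI[of _ 1], rule exI[of _ "\<lambda>_. r *\<^sub>R a"], rule exI[of _ "\<lambda>_. b"])
      (simp add: bilinear_lmul[OF bilinear_tensor_of])
  have "?P (abs_tensor p)" for p
  proof (induction p rule: update_induct)
    case const
    then show ?case using zero by (simp add: zero_tensor.abs_eq)
  next
    case (update p k c)
    have "Poly_Mapping.update k c p = p + c *\<^sub>R Poly_Mapping.single k 1"
      using update(1)
      by (intro poly_mapping_eqI) (auto simp: lookup_update lookup_add lookup_scaleR_real
          lookup_single in_keys_iff when_def)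
    then have "abs_tensor (Poly_Mapping.update k c p) = abs_tensor p + c *\<^sub>R tensor_of (fst k) (snd k)"
      by (simp add: plus_tensor.abs_eq tensor_of.abs_eq scaleR_tensor.abs_eq)
    then show ?case using add[OF update(3) one] by simp
  qed
  then show ?thesis by (induction z) auto
qed

lemma bounded_linear_finite_rank_on:
  fixes S :: "'a::real_normed_vector set"
  assumes "finite S"
  shows "\<exists>k \<phi> e. (\<forall>j<(k::nat). bounded_linear (\<phi> j :: 'a \<Rightarrow> real)) \<and> (\<forall>x\<in>S. x = (\<Sum>j<k. \<phi> j x *\<^sub>R e j))"
  using assms
proof (induction S)
  case empty
  then show ?case by (auto intro: exI[of _ 0])
next
  case (insert a S)
  then obtain k \<phi> e where b: "\<forall>j<(k::nat). bounded_linear (\<phi> j :: 'a \<Rightarrow> real)"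
    and S: "\<forall>x\<in>S. x = (\<Sum>j<k. \<phi> j x *\<^sub>R e j)" by blast
  define P where "P = (\<lambda>x. \<Sum>j<k. \<phi> j x *\<^sub>R e j)"
  have P: "bounded_linear P" unfolding P_def
    by (rule bounded_linear_sum) (use b in \<open>auto intro: bounded_linear_scaleR_const\<close>)
  show ?case
  proof (cases "P a = a")
    case True
    then show ?thesis using b S unfolding P_def by (intro exI[of _ k] exI[of _ \<phi>] exI[of _ e]) auto
  next
    case False
    define v where "v = a - P a"
    have v: "norm v \<noteq> 0" using False by (simp add: v_def)
    obtain \<psi> :: "'a \<Rightarrow> real" where \<psi>: "bounded_linear \<psi>" "\<psi> v = norm v"
      using norming_functional by blast
    define \<theta> where "\<theta> = (\<lambda>x. \<psi> (x - P x) / norm v)"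
    have \<theta>: "bounded_linear \<theta>" unfolding \<theta>_def
      using bounded_linear_compose[OF \<psi>(1) bounded_linear_sub[OF bounded_linear_ident P]]
      by (rule bounded_linear_compose[OF bounded_linear_divide])
    have eq: "(\<Sum>j<Suc k. (\<phi>(k := \<theta>)) j x *\<^sub>R (e(k := v)) j) = P x + \<theta> x *\<^sub>R v" for x
      by (simp add: P_def)
    have "\<theta> a = 1" using \<psi>(2) v by (simp add: \<theta>_def v_def)
    moreover have "\<theta> x = 0" if "x \<in> S" for x
      using S that linear_0[OF bounded_linear.linear[OF \<psi>(1)]] by (simp add: \<theta>_def P_def)
    ultimately have "\<forall>x\<in>insert a S. x = (\<Sum>j<Suc k. (\<phi>(k := \<theta>)) j x *\<^sub>R (e(k := v)) j)"
      unfolding eq using S by (auto simp: v_def P_def)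
    moreover have "\<forall>j<Suc k. bounded_linear ((\<phi>(k := \<theta>)) j)"
      using b \<theta> by auto
    ultimately show ?thesis by blast
  qed
qed

instantiation tensor :: (real_normed_vector, real_normed_vector) real_normed_vector
begin

definition norm_tensor :: "('a, 'b) tensor \<Rightarrow> real" where
  "norm_tensor z = Inf {\<Sum>i<k. norm (x i) * norm (y i) | (k::nat) x y. z = (\<Sum>i<k. tensor_of (x i) (y i))}"

definition dist_tensor :: "('a, 'b) tensor \<Rightarrow> ('a, 'b) tensor \<Rightarrow> real" where
  "dist_tensor z w = norm (z - w)"

definition sgn_tensor :: "('a, 'b) tensor \<Rightarrow> ('a, 'b) tensor" where
  "sgn_tensor z = z /\<^sub>R norm z"

definition uniformity_tensor :: "(('a, 'b) tensor \<times> ('a, 'b) tensor) filter" where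
  "uniformity_tensor = (INF e\<in>{0<..}. principal {(z, w). dist z w < e})"

definition open_tensor :: "('a, 'b) tensor set \<Rightarrow> bool" where
  "open_tensor U \<longleftrightarrow> (\<forall>z\<in>U. \<forall>\<^sub>F (z', w) in uniformity. z' = z \<longrightarrow> w \<in> U)"

lemma tensor_norm_le:
  fixes z :: "('a, 'b) tensor"
  assumes "z = (\<Sum>i<(k::nat). tensor_of (x i) (y i))"
  shows "norm z \<le> (\<Sum>i<k. norm (x i) * norm (y i))"
  unfolding norm_tensor_def
  by (rule cInf_lower) (use assms in \<open>auto intro!: bdd_belowI[of _ 0] sum_nonneg\<close>)

lemma tensor_norm_greatest:
  fixes z :: "('a, 'b) tensor"
  assumes "\<And>k x y. z = (\<Sum>i<(k::nat). tensor_of (x i) (y i)) \<Longrightarrow> c \<le> (\<Sum>i<k. norm (x i) * norm (y i))"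
  shows "c \<le> norm z"
  unfolding norm_tensor_def
  by (rule cInf_greatest) (use assms tensor_sum_exists[of z] in auto)

lemma tensor_functional_le:
  fixes L :: "('a, 'b) tensor \<Rightarrow> real"
  assumes L: "linear L" and C: "0 \<le> C" "\<And>x y. \<bar>L (tensor_of x y)\<bar> \<le> C * (norm x * norm y)"
  shows "\<bar>L z\<bar> \<le> C * norm z"
proof (cases "C = 0")
  case True
  obtain k x y where "z = (\<Sum>i<(k::nat). tensor_of (x i) (y i))" using tensor_sum_exists by blast
  then show ?thesis using C True by (simp add: linear_sum[OF L])
next
  case False
  then have C0: "C > 0" using C by simp
  have "\<bar>L z\<bar> / C \<le> norm z"
  proof (rule tensor_norm_greatest)
    fix k x y assume z: "z = (\<Sum>i<(k::nat). tensor_of (x i) (y i))"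
    have "\<bar>L z\<bar> \<le> (\<Sum>i<k. \<bar>L (tensor_of (x i) (y i))\<bar>)"
      by (simp add: z linear_sum[OF L])
    also have "\<dots> \<le> (\<Sum>i<k. C * (norm (x i) * norm (y i)))"
      by (rule sum_mono) (rule C)
    finally show "\<bar>L z\<bar> / C \<le> (\<Sum>i<k. norm (x i) * norm (y i))"
      using C0 by (simp add: sum_distrib_left[symmetric] field_simps)
  qed
  then show ?thesis using C0 by (simp add: field_simps)
qed

lemma tensor_norm_scale_le: "norm (r *\<^sub>R z) \<le> \<bar>r\<bar> * norm (z :: ('a, 'b) tensor)"
proof (cases "r = 0")
  case True
  then show ?thesis using tensor_norm_le[where z = "r *\<^sub>R z" and k = 0] by simp
next
  case False
  have "norm (r *\<^sub>R z) / \<bar>r\<bar> \<le> norm z"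
  proof (rule tensor_norm_greatest)
    fix k x y assume z: "z = (\<Sum>i<(k::nat). tensor_of (x i) (y i))"
    have "norm (r *\<^sub>R z) \<le> (\<Sum>i<k. norm (r *\<^sub>R x i) * norm (y i))"
      by (rule tensor_norm_le) (simp add: z scaleR_sum_right bilinear_lmul[OF bilinear_tensor_of])
    then show "norm (r *\<^sub>R z) / \<bar>r\<bar> \<le> (\<Sum>i<k. norm (x i) * norm (y i))"
      using False by (simp add: field_simps sum_distrib_left)
  qed
  then show ?thesis using False by (simp add: field_simps)
qed

lemma tensor_norm_triangle: "norm (z + w) \<le> norm z + norm (w :: ('a, 'b) tensor)"
proof -
  have *: "norm (z + w) \<le> (\<Sum>i<k. norm (x i) * norm (y i)) + (\<Sum>i<l. norm (u i) * norm (v i))"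
    if z: "z = (\<Sum>i<(k::nat). tensor_of (x i) (y i))" and w: "w = (\<Sum>i<(l::nat). tensor_of (u i) (v i))"
    for k x y l u v
  proof -
    let ?a = "\<lambda>i. if i < k then x i else u (i - k)"
    let ?b = "\<lambda>i. if i < k then y i else v (i - k)"
    have "z + w = (\<Sum>i<k + l. if i < k then tensor_of (x i) (y i) else tensor_of (u (i - k)) (v (i - k)))"
      unfolding z w by (rule sum_lessThan_append[symmetric])
    also have "\<dots> = (\<Sum>i<k + l. tensor_of (?a i) (?b i))"
      by (rule sum.cong) auto
    finally have "norm (z + w) \<le> (\<Sum>i<k + l. norm (?a i) * norm (?b i))"
      by (rule tensor_norm_le)
    also have "\<dots> = (\<Sum>i<k + l. if i < k then norm (x i) * norm (y i) else norm (u (i - k)) * norm (v (i - k)))"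
      by (rule sum.cong) auto
    also have "\<dots> = (\<Sum>i<k. norm (x i) * norm (y i)) + (\<Sum>i<l. norm (u i) * norm (v i))"
      by (rule sum_lessThan_append)
    finally show ?thesis .
  qed
  have "norm (z + w) - (\<Sum>i<l. norm (u i) * norm (v i)) \<le> norm z"
    if "w = (\<Sum>i<(l::nat). tensor_of (u i) (v i))" for l u v
    by (rule tensor_norm_greatest) (use *[OF _ that] in \<open>simp add: algebra_simps\<close>)
  then have "norm (z + w) - norm z \<le> norm w"
    by (intro tensor_norm_greatest) (simp add: algebra_simps)
  then show ?thesis by simp
qed

lemma tensor_norm_zero_imp:
  fixes z :: "('a, 'b) tensor"
  assumes "norm z = 0" shows "z = 0"
proof -
  obtain k x y where z: "z = (\<Sum>i<(k::nat). tensor_of (x i) (y i))" using tensor_sum_exists by blast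
  have pair: "(\<Sum>i<k. \<phi> (x i) * \<psi> (y i)) = 0"
    if \<phi>: "bounded_linear \<phi>" and \<psi>: "bounded_linear \<psi>" for \<phi> :: "'a \<Rightarrow> real" and \<psi> :: "'b \<Rightarrow> real"
  proof -
    have bil: "bilinear (\<lambda>a b. \<phi> a * \<psi> b)"
      using bounded_linear.linear[OF \<phi>] bounded_linear.linear[OF \<psi>]
      by (auto simp: bilinear_def linear_iff algebra_simps)
    obtain L :: "('a, 'b) tensor \<Rightarrow> real" where L: "linear L" "\<And>a b. L (tensor_of a b) = \<phi> a * \<psi> b"
      using tensor_universal[OF bil] by blast
    obtain K K' where K: "0 < K" "\<And>a. norm (\<phi> a) \<le> norm a * K"
      and K': "0 < K'" "\<And>b. norm (\<psi> b) \<le> norm b * K'"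
      using bounded_linear.pos_bounded[OF \<phi>] bounded_linear.pos_bounded[OF \<psi>] by blast
    have "\<bar>L (tensor_of a b)\<bar> \<le> (K * K') * (norm a * norm b)" for a b
    proof -
      have "\<bar>\<phi> a\<bar> * \<bar>\<psi> b\<bar> \<le> (norm a * K) * (norm b * K')"
        using K(2)[of a] K'(2)[of b] K(1) by (intro mult_mono) auto
      then show ?thesis by (simp add: L(2) abs_mult algebra_simps)
    qed
    from tensor_functional_le[OF L(1) _ this, of z]
    have "L z = 0" using assms K K' by simp
    then show ?thesis by (simp add: z linear_sum[OF L(1)] L(2))
  qed
  obtain m \<phi> e where b: "\<forall>j<(m::nat). bounded_linear (\<phi> j :: 'a \<Rightarrow> real)"
    and e: "\<forall>a\<in>x ` {..<k}. a = (\<Sum>j<m. \<phi> j a *\<^sub>R e j)"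
    using bounded_linear_finite_rank_on[of "x ` {..<k}"] by auto
  have inner: "(\<Sum>i<k. \<phi> j (x i) *\<^sub>R y i) = 0" if "j < m" for j
  proof -
    obtain \<psi> :: "'b \<Rightarrow> real" where \<psi>: "bounded_linear \<psi>"
      "\<psi> (\<Sum>i<k. \<phi> j (x i) *\<^sub>R y i) = norm (\<Sum>i<k. \<phi> j (x i) *\<^sub>R y i)"
      using norming_functional by blast
    note lin = bounded_linear.linear[OF \<psi>(1)]
    have "\<psi> (\<Sum>i<k. \<phi> j (x i) *\<^sub>R y i) = (\<Sum>i<k. \<phi> j (x i) * \<psi> (y i))"
      by (simp add: linear_sum[OF lin] linear_scale[OF lin])
    also have "\<dots> = 0" using pair[OF _ \<psi>(1)] b that by blast
    finally show ?thesis using \<psi>(2) by simp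
  qed
  note bt = bilinear_tensor_of[where 'a = 'a and 'b = 'b]
  have lin1: "linear (\<lambda>a::'a. tensor_of a b)" for b :: 'b using bt by (simp add: bilinear_def)
  have lin2: "linear (tensor_of a :: 'b \<Rightarrow> ('a, 'b) tensor)" for a using bt by (simp add: bilinear_def)
  have "z = (\<Sum>i<k. \<Sum>j<m. tensor_of (e j) (\<phi> j (x i) *\<^sub>R y i))"
    unfolding z
  proof (rule sum.cong)
    fix i assume i: "i \<in> {..<k}"
    have "tensor_of (x i) (y i) = tensor_of (\<Sum>j<m. \<phi> j (x i) *\<^sub>R e j) (y i)"
      using e i by (metis imageI)
    also have "\<dots> = (\<Sum>j<m. \<phi> j (x i) *\<^sub>R tensor_of (e j) (y i))"
      by (simp add: linear_sum[OF lin1] bilinear_lmul[OF bt])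
    finally show "tensor_of (x i) (y i) = (\<Sum>j<m. tensor_of (e j) (\<phi> j (x i) *\<^sub>R y i))"
      by (simp add: bilinear_rmul[OF bt])
  qed auto
  also have "\<dots> = (\<Sum>j<m. \<Sum>i<k. tensor_of (e j) (\<phi> j (x i) *\<^sub>R y i))"
    by (rule sum.swap)
  also have "\<dots> = (\<Sum>j<m. tensor_of (e j) (\<Sum>i<k. \<phi> j (x i) *\<^sub>R y i))"
    by (simp add: linear_sum[OF lin2])
  also have "\<dots> = 0" by (simp add: inner linear_0[OF lin2])
  finally show ?thesis .
qed

instance
proof
  fix z w :: "('a, 'b) tensor" and r :: real and U :: "('a, 'b) tensor set"
  show "dist z w = norm (z - w)" by (rule dist_tensor_def)
  show "sgn z = z /\<^sub>R norm z" by (rule sgn_tensor_def)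
  show "uniformity = (INF e\<in>{0<..}. principal {(z, w::('a, 'b) tensor). dist z w < e})"
    by (rule uniformity_tensor_def)
  show "open U = (\<forall>z\<in>U. \<forall>\<^sub>F (z', w) in uniformity. z' = z \<longrightarrow> w \<in> U)"
    by (rule open_tensor_def)
  have ge0: "0 \<le> norm z" for z :: "('a, 'b) tensor"
    by (rule tensor_norm_greatest) (auto intro: sum_nonneg)
  have "norm (0 :: ('a, 'b) tensor) \<le> 0" using tensor_norm_le[where z = 0 and k = 0] by simp
  then have n0: "norm (0 :: ('a, 'b) tensor) = 0" using ge0[of 0] by linarith
  then show "norm z = 0 \<longleftrightarrow> z = 0" using tensor_norm_zero_imp by blast
  show "norm (z + w) \<le> norm z + norm w" by (rule tensor_norm_triangle)
  show "norm (r *\<^sub>R z) = \<bar>r\<bar> * norm z"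
  proof (cases "r = 0")
    case False
    have "norm ((1 / r) *\<^sub>R (r *\<^sub>R z)) \<le> \<bar>1 / r\<bar> * norm (r *\<^sub>R z)" by (rule tensor_norm_scale_le)
    then have "\<bar>r\<bar> * norm z \<le> norm (r *\<^sub>R z)" using False by (simp add: field_simps)
    then show ?thesis using tensor_norm_scale_le[of r z] by linarith
  qed (simp add: n0)
qed

end

text \<open>
  The completion of a normed space: Cauchy sequences modulo null sequences, the norm being the limit
  of the norms.
\<close>

definition completion_rel :: "(nat \<Rightarrow> 'a::real_normed_vector) \<Rightarrow> (nat \<Rightarrow> 'a) \<Rightarrow> bool" where
  "completion_rel X Y \<longleftrightarrow> Cauchy X \<and> Cauchy Y \<and> (\<lambda>n. X n - Y n) \<longlonglongrightarrow> 0"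

lemma completion_rel_refl: "completion_rel X X \<longleftrightarrow> Cauchy X"
  by (simp add: completion_rel_def)

lemma Cauchy_const_seq: "Cauchy (\<lambda>_. c :: 'a::real_normed_vector)"
  by (simp add: convergent_Cauchy convergent_const)

lemma part_equivp_completion_rel:
  "part_equivp (completion_rel :: (nat \<Rightarrow> 'a::real_normed_vector) \<Rightarrow> _)"
proof (rule part_equivpI)
  show "\<exists>X::nat \<Rightarrow> 'a. completion_rel X X"
    by (rule exI[of _ "\<lambda>_. 0"]) (simp add: completion_rel_refl Cauchy_const_seq)
  show "symp (completion_rel :: (nat \<Rightarrow> 'a) \<Rightarrow> _)"
  proof (rule sympI)
    fix X Y :: "nat \<Rightarrow> 'a" assume "completion_rel X Y"
    then show "completion_rel Y X"
      unfolding completion_rel_def using tendsto_minus[of "\<lambda>n. X n - Y n" 0 sequentially] by simp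
  qed
  show "transp (completion_rel :: (nat \<Rightarrow> 'a) \<Rightarrow> _)"
  proof (rule transpI)
    fix X Y Z :: "nat \<Rightarrow> 'a" assume "completion_rel X Y" "completion_rel Y Z"
    then show "completion_rel X Z"
      unfolding completion_rel_def
      using tendsto_add[of "\<lambda>n. X n - Y n" 0 sequentially "\<lambda>n. Y n - Z n" 0] by simp
  qed
qed

quotient_type (overloaded) 'a completion = "nat \<Rightarrow> 'a::real_normed_vector" / partial: completion_rel
  by (rule part_equivp_completion_rel)

lemma Cauchy_add_seq:
  fixes X Y :: "nat \<Rightarrow> 'a::real_normed_vector"
  assumes "Cauchy X" "Cauchy Y" shows "Cauchy (\<lambda>n. X n + Y n)"
proof (rule CauchyI)
  fix e :: real assume "0 < e"
  then obtain M N where "\<forall>m\<ge>M. \<forall>n\<ge>M. norm (X m - X n) < e/2" "\<forall>m\<ge>N. \<forall>n\<ge>N. norm (Y m - Y n) < e/2"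
    using CauchyD[OF assms(1), of "e/2"] CauchyD[OF assms(2), of "e/2"] by auto
  then have "norm (X m - X n) < e/2" "norm (Y m - Y n) < e/2" if "m \<ge> max M N" "n \<ge> max M N" for m n
    using that by auto
  then have "norm (X m + Y m - (X n + Y n)) < e" if "m \<ge> max M N" "n \<ge> max M N" for m n
    unfolding add_diff_add using that by (intro norm_triangle_lt) force
  then show "\<exists>M. \<forall>m\<ge>M. \<forall>n\<ge>M. norm (X m + Y m - (X n + Y n)) < e" by blast
qed

lemma Cauchy_scaleR_seq:
  fixes X :: "nat \<Rightarrow> 'a::real_normed_vector"
  shows "Cauchy X \<Longrightarrow> Cauchy (\<lambda>n. r *\<^sub>R X n)"
  by (rule bounded_linear.Cauchy[OF bounded_linear_scaleR_right])

lemma Cauchy_minus_seq: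
  fixes X :: "nat \<Rightarrow> 'a::real_normed_vector"
  shows "Cauchy X \<Longrightarrow> Cauchy (\<lambda>n. - X n)"
  using Cauchy_scaleR_seq[of X "-1"] by simp

lemma Cauchy_diff_seq:
  fixes X Y :: "nat \<Rightarrow> 'a::real_normed_vector"
  shows "Cauchy X \<Longrightarrow> Cauchy Y \<Longrightarrow> Cauchy (\<lambda>n. X n - Y n)"
  using Cauchy_add_seq[OF _ Cauchy_minus_seq, of X Y] by simp

lemma Cauchy_norm_seq:
  fixes X :: "nat \<Rightarrow> 'a::real_normed_vector"
  assumes "Cauchy X" shows "convergent (\<lambda>n. norm (X n))"
proof (rule real_Cauchy_convergent, rule CauchyI)
  fix e :: real assume "0 < e"
  then obtain M where M: "\<forall>m\<ge>M. \<forall>n\<ge>M. norm (X m - X n) < e" using CauchyD[OF assms] by blast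
  have "norm (norm (X m) - norm (X n)) < e" if "m \<ge> M" "n \<ge> M" for m n
    using M that norm_triangle_ineq3[of "X m" "X n"] by fastforce
  then show "\<exists>M. \<forall>m\<ge>M. \<forall>n\<ge>M. norm (norm (X m) - norm (X n)) < e" by blast
qed

instantiation completion :: (real_normed_vector) real_vector
begin

lift_definition zero_completion :: "'a completion" is "\<lambda>_. 0"
  by (simp add: completion_rel_refl Cauchy_const_seq)

lift_definition plus_completion :: "'a completion \<Rightarrow> 'a completion \<Rightarrow> 'a completion"
  is "\<lambda>X Y n. X n + Y n"
proof -
  fix X X' Y Y' :: "nat \<Rightarrow> 'a"
  assume "completion_rel X X'" "completion_rel Y Y'"
  then show "completion_rel (\<lambda>n. X n + Y n) (\<lambda>n. X' n + Y' n)"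
    using tendsto_add[of "\<lambda>n. X n - X' n" 0 sequentially "\<lambda>n. Y n - Y' n" 0]
    by (auto simp: completion_rel_def add_diff_add intro: Cauchy_add_seq)
qed

lift_definition uminus_completion :: "'a completion \<Rightarrow> 'a completion" is "\<lambda>X n. - X n"
proof -
  fix X X' :: "nat \<Rightarrow> 'a"
  assume "completion_rel X X'"
  then show "completion_rel (\<lambda>n. - X n) (\<lambda>n. - X' n)"
    using tendsto_minus[of "\<lambda>n. X n - X' n" 0 sequentially]
    by (auto simp: completion_rel_def minus_diff_minus intro: Cauchy_minus_seq)
qed

lift_definition minus_completion :: "'a completion \<Rightarrow> 'a completion \<Rightarrow> 'a completion"
  is "\<lambda>X Y n. X n - Y n"
proof -
  fix X X' Y Y' :: "nat \<Rightarrow> 'a"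
  assume "completion_rel X X'" "completion_rel Y Y'"
  moreover have "(\<lambda>n. X n - Y n - (X' n - Y' n)) = (\<lambda>n. (X n - X' n) - (Y n - Y' n))" by auto
  ultimately show "completion_rel (\<lambda>n. X n - Y n) (\<lambda>n. X' n - Y' n)"
    using tendsto_diff[of "\<lambda>n. X n - X' n" 0 sequentially "\<lambda>n. Y n - Y' n" 0]
    unfolding completion_rel_def by (metis Cauchy_diff_seq diff_zero)
qed

lift_definition scaleR_completion :: "real \<Rightarrow> 'a completion \<Rightarrow> 'a completion"
  is "\<lambda>r X n. r *\<^sub>R X n"
proof -
  fix r :: real and X X' :: "nat \<Rightarrow> 'a"
  assume "completion_rel X X'"
  then show "completion_rel (\<lambda>n. r *\<^sub>R X n) (\<lambda>n. r *\<^sub>R X' n)"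
    using tendsto_scaleR[OF tendsto_const[of r], of "\<lambda>n. X n - X' n" 0 sequentially]
    by (auto simp: completion_rel_def scaleR_diff_right intro: Cauchy_scaleR_seq)
qed

lemma completion_cases:
  obtains X :: "nat \<Rightarrow> 'a" where "Cauchy X" "z = abs_completion X"
proof -
  have "completion_rel (rep_completion z) (rep_completion z)"
    by (rule Quotient_rep_reflp[OF Quotient_completion])
  moreover have "z = abs_completion (rep_completion z)"
    by (rule Quotient_abs_rep[OF Quotient_completion, symmetric])
  ultimately show ?thesis using that by (auto simp: completion_rel_refl)
qed

lemma abs_completion_eq_iff:
  "Cauchy X \<Longrightarrow> Cauchy Y \<Longrightarrow> abs_completion X = abs_completion Y \<longleftrightarrow> (\<lambda>n. X n - Y n :: 'a) \<longlonglongrightarrow> 0"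
  using Quotient_rel[OF Quotient_completion, of X Y] by (auto simp: completion_rel_def)

lemma abs_completion_simps:
  fixes X Y :: "nat \<Rightarrow> 'a"
  assumes "Cauchy X"
  shows "Cauchy Y \<Longrightarrow> abs_completion X + abs_completion Y = abs_completion (\<lambda>n. X n + Y n)"
    and "Cauchy Y \<Longrightarrow> abs_completion X - abs_completion Y = abs_completion (\<lambda>n. X n - Y n)"
    and "- abs_completion X = abs_completion (\<lambda>n. - X n)"
    and "r *\<^sub>R abs_completion X = abs_completion (\<lambda>n. r *\<^sub>R X n)"
  using assms
  by (simp_all add: plus_completion.abs_eq minus_completion.abs_eq uminus_completion.abs_eq
      scaleR_completion.abs_eq completion_rel_refl eq_onp_def)

instance
proof
  note C = Cauchy_add_seq Cauchy_scaleR_seq Cauchy_minus_seq Cauchy_diff_seq Cauchy_const_seq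
  fix z w u :: "'a completion" and r s :: real
  obtain X where X: "Cauchy X" "z = abs_completion X" by (rule completion_cases)
  obtain Y where Y: "Cauchy Y" "w = abs_completion Y" by (rule completion_cases)
  obtain Z where Z: "Cauchy Z" "u = abs_completion Z" by (rule completion_cases)
  show "z + w + u = z + (w + u)"
    using X Y Z by (simp add: abs_completion_simps C add.assoc)
  show "z + w = w + z"
    using X Y by (simp add: abs_completion_simps C add.commute)
  show "0 + z = z"
    using X by (simp add: zero_completion_def abs_completion_simps C)
  show "- z + z = 0"
    using X by (simp add: zero_completion_def abs_completion_simps C)
  show "z - w = z + - w"
    using X Y by (simp add: abs_completion_simps C)
  show "r *\<^sub>R (z + w) = r *\<^sub>R z + r *\<^sub>R w"
    using X Y by (simp add: abs_completion_simps C scaleR_add_right)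
  show "(r + s) *\<^sub>R z = r *\<^sub>R z + s *\<^sub>R z"
    using X by (simp add: abs_completion_simps C scaleR_add_left)
  show "r *\<^sub>R s *\<^sub>R z = (r * s) *\<^sub>R z"
    using X by (simp add: abs_completion_simps C)
  show "1 *\<^sub>R z = z"
    using X by (simp add: abs_completion_simps C)
qed

end

instantiation completion :: (real_normed_vector) real_normed_vector
begin

lift_definition norm_completion :: "'a completion \<Rightarrow> real" is "\<lambda>X. lim (\<lambda>n. norm (X n))"
proof -
  fix X X' :: "nat \<Rightarrow> 'a"
  assume "completion_rel X X'"
  then have C: "Cauchy X" "Cauchy X'" and 0: "(\<lambda>n. X n - X' n) \<longlonglongrightarrow> 0"
    by (auto simp: completion_rel_def)
  have "(\<lambda>n. norm (X n) - norm (X' n)) \<longlonglongrightarrow> 0"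
    by (rule tendsto_0_le[OF 0, of _ 1]) (simp add: norm_triangle_ineq3)
  moreover have "(\<lambda>n. norm (X n) - norm (X' n)) \<longlonglongrightarrow> lim (\<lambda>n. norm (X n)) - lim (\<lambda>n. norm (X' n))"
    using C[THEN Cauchy_norm_seq] by (intro tendsto_diff) (simp_all add: convergent_LIMSEQ_iff)
  ultimately show "lim (\<lambda>n. norm (X n)) = lim (\<lambda>n. norm (X' n))"
    using LIMSEQ_unique by fastforce
qed

definition dist_completion :: "'a completion \<Rightarrow> 'a completion \<Rightarrow> real" where
  "dist_completion z w = norm (z - w)"

definition sgn_completion :: "'a completion \<Rightarrow> 'a completion" where
  "sgn_completion z = z /\<^sub>R norm z"

definition uniformity_completion :: "('a completion \<times> 'a completion) filter" where
  "uniformity_completion = (INF e\<in>{0<..}. principal {(z, w). dist z w < e})"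

definition open_completion :: "'a completion set \<Rightarrow> bool" where
  "open_completion U \<longleftrightarrow> (\<forall>z\<in>U. \<forall>\<^sub>F (z', w) in uniformity. z' = z \<longrightarrow> w \<in> U)"

lemma LIMSEQ_norm_abs_completion:
  fixes X :: "nat \<Rightarrow> 'a"
  assumes "Cauchy X"
  shows "(\<lambda>n. norm (X n)) \<longlonglongrightarrow> norm (abs_completion X)"
  using Cauchy_norm_seq[OF assms] assms
  by (simp add: norm_completion.abs_eq completion_rel_refl convergent_LIMSEQ_iff)

instance
proof
  note C = Cauchy_add_seq Cauchy_scaleR_seq Cauchy_minus_seq Cauchy_diff_seq Cauchy_const_seq
  fix z w :: "'a completion" and r :: real and U :: "'a completion set"
  obtain X where X: "Cauchy X" "z = abs_completion X" by (rule completion_cases)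
  obtain Y where Y: "Cauchy Y" "w = abs_completion Y" by (rule completion_cases)
  show "dist z w = norm (z - w)" by (rule dist_completion_def)
  show "sgn z = z /\<^sub>R norm z" by (rule sgn_completion_def)
  show "uniformity = (INF e\<in>{0<..}. principal {(z, w::'a completion). dist z w < e})"
    by (rule uniformity_completion_def)
  show "open U = (\<forall>z\<in>U. \<forall>\<^sub>F (z', w) in uniformity. z' = z \<longrightarrow> w \<in> U)"
    by (rule open_completion_def)
  show "norm z = 0 \<longleftrightarrow> z = 0"
  proof -
    have "norm z = 0 \<longleftrightarrow> (\<lambda>n. norm (X n)) \<longlonglongrightarrow> 0"
      using LIMSEQ_norm_abs_completion[OF X(1)] X(2) LIMSEQ_unique by metis
    also have "\<dots> \<longleftrightarrow> z = 0"
      using X by (simp add: zero_completion_def abs_completion_eq_iff C tendsto_norm_zero_iff)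
    finally show ?thesis .
  qed
  show "norm (z + w) \<le> norm z + norm w"
  proof -
    have "(\<lambda>n. norm (X n + Y n)) \<longlonglongrightarrow> norm (z + w)"
      using LIMSEQ_norm_abs_completion[OF Cauchy_add_seq[OF X(1) Y(1)]] X Y
      by (simp add: abs_completion_simps)
    moreover have "(\<lambda>n. norm (X n) + norm (Y n)) \<longlonglongrightarrow> norm z + norm w"
      using LIMSEQ_norm_abs_completion[OF X(1)] LIMSEQ_norm_abs_completion[OF Y(1)] X Y
      by (intro tendsto_add) auto
    ultimately show ?thesis
      by (rule LIMSEQ_le) (auto simp: norm_triangle_ineq)
  qed
  show "norm (r *\<^sub>R z) = \<bar>r\<bar> * norm z"
  proof -
    have "(\<lambda>n. norm (r *\<^sub>R X n)) \<longlonglongrightarrow> norm (r *\<^sub>R z)"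
      using LIMSEQ_norm_abs_completion[OF Cauchy_scaleR_seq[OF X(1)]] X
      by (simp add: abs_completion_simps)
    moreover have "(\<lambda>n. norm (r *\<^sub>R X n)) \<longlonglongrightarrow> \<bar>r\<bar> * norm z"
      using tendsto_mult_left[OF LIMSEQ_norm_abs_completion[OF X(1)], of "\<bar>r\<bar>"] X by simp
    ultimately show ?thesis by (rule LIMSEQ_unique)
  qed
qed

end

lift_definition to_completion :: "'a::real_normed_vector \<Rightarrow> 'a completion" is "\<lambda>x _. x"
  by (simp add: completion_rel_refl Cauchy_const_seq)

lemma to_completion_eq: "to_completion x = abs_completion (\<lambda>_. x)"
  by (rule to_completion.abs_eq)

lemma linear_to_completion: "linear to_completion"
  by (rule linearI) (simp_all add: to_completion_eq abs_completion_simps Cauchy_const_seq)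

lemma norm_to_completion: "norm (to_completion x) = norm x"
  using LIMSEQ_norm_abs_completion[OF Cauchy_const_seq[of x]] LIMSEQ_unique tendsto_const
  unfolding to_completion_eq by metis

lemma to_completion_tendsto:
  fixes X :: "nat \<Rightarrow> 'a::real_normed_vector"
  assumes X: "Cauchy X"
  shows "(\<lambda>n. to_completion (X n)) \<longlonglongrightarrow> abs_completion X"
proof (rule LIMSEQ_I)
  fix e :: real assume "0 < e"
  then obtain M where M: "\<forall>m\<ge>M. \<forall>n\<ge>M. norm (X m - X n) < e/2"
    using CauchyD[OF X, of "e/2"] by auto
  have "norm (to_completion (X n) - abs_completion X) < e" if n: "n \<ge> M" for n
  proof -
    have "(\<lambda>m. norm (X n - X m)) \<longlonglongrightarrow> norm (to_completion (X n) - abs_completion X)"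
      using LIMSEQ_norm_abs_completion[OF Cauchy_diff_seq[OF Cauchy_const_seq[of "X n"] X]] X
      by (simp add: to_completion_eq abs_completion_simps Cauchy_const_seq)
    then have "norm (to_completion (X n) - abs_completion X) \<le> e/2"
      by (rule LIMSEQ_le_const2) (use M n in \<open>auto intro!: exI[of _ M] less_imp_le\<close>)
    then show ?thesis using \<open>0 < e\<close> by simp
  qed
  then show "\<exists>no. \<forall>n\<ge>no. norm (to_completion (X n) - abs_completion X) < e" by blast
qed

lemma to_completion_dense: "closure (range to_completion) = (UNIV :: 'a::real_normed_vector completion set)"
proof -
  have "z \<in> closure (range to_completion)" for z :: "'a completion"
  proof -
    obtain X where X: "Cauchy X" "z = abs_completion X" by (rule completion_cases)
    show ?thesis unfolding closure_sequential X(2)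
      by (rule exI[of _ "\<lambda>n. to_completion (X n)"]) (use to_completion_tendsto[OF X(1)] in auto)
  qed
  then show ?thesis by auto
qed

instance completion :: (real_normed_vector) banach
proof
  fix F :: "nat \<Rightarrow> 'a completion" assume F: "Cauchy F"
  have "\<exists>a. dist (to_completion a) (F n) < 1 / Suc n" for n
  proof -
    have "F n \<in> closure (range to_completion)" by (simp add: to_completion_dense)
    then show ?thesis unfolding closure_approachable
      by (metis (no_types, lifting) imageE of_nat_0_less_iff zero_less_Suc zero_less_divide_1_iff)
  qed
  then obtain a where a: "dist (to_completion (a n)) (F n) < 1 / Suc n" for n by metis
  have D: "(\<lambda>n. to_completion (a n) - F n) \<longlonglongrightarrow> 0"
  proof (rule tendsto_norm_zero_cancel, rule tendsto_sandwich[OF _ _ tendsto_const])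
    show "(\<lambda>n. 1 / real (Suc n)) \<longlonglongrightarrow> 0" using LIMSEQ_inverse_real_of_nat by (simp add: inverse_eq_divide)
    show "\<forall>\<^sub>F n in sequentially. norm (to_completion (a n) - F n) \<le> 1 / real (Suc n)"
      using a by (auto simp: dist_norm intro!: always_eventually less_imp_le)
  qed auto
  have "Cauchy (\<lambda>n. to_completion (a n))"
    using Cauchy_add_seq[OF LIMSEQ_imp_Cauchy[OF D] F] by simp
  then have "Cauchy a"
    unfolding Cauchy_iff by (simp add: linear_diff[OF linear_to_completion, symmetric] norm_to_completion)
  from tendsto_diff[OF to_completion_tendsto[OF this] D]
  show "convergent F" unfolding convergent_def by auto
qed

type_synonym ('a, 'b) proj_tensor = "('a, 'b) tensor completion"

definition proj_tensor_of ::
    "'a::real_normed_vector \<Rightarrow> 'b::real_normed_vector \<Rightarrow> ('a, 'b) proj_tensor"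
    (infixl "\<otimes>\<^sub>\<pi>" 70) where
  "x \<otimes>\<^sub>\<pi> y = to_completion (tensor_of x y)"

text \<open>The supremum is only meaningful for a map satisfying \<^const>\<open>bounded_bilinear\<close>.\<close>

definition bilinear_norm ::
    "('a::real_normed_vector \<Rightarrow> 'b::real_normed_vector \<Rightarrow> real) \<Rightarrow> real" where
  "bilinear_norm B = (SUP (x, y) \<in> cball 0 1 \<times> cball 0 1. \<bar>B x y\<bar>)"

definition ssd_point :: "'a::real_normed_vector \<Rightarrow> bool" where
  "ssd_point x \<longleftrightarrow> x \<in> sphere 0 1 \<and>
     (\<exists>l. uniform_limit (sphere 0 1) (\<lambda>t h. (norm (x + t *\<^sub>R h) - 1) / t) l (at_right 0))"

end

theory Submission
  imports Defs
begin

text \<open>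
  The theorem is an instance of the duality between strong subdifferentiability and norm-attaining
  functionals (Franchetti and Paya): a unit vector \<open>z\<close> is an SSD point if and only if every functional
  \<open>f\<close> in the dual ball with \<open>f z\<close> close to \<open>1\<close> is close in norm to some \<open>g\<close> in the dual ball with
  \<open>g z = 1\<close>. This is \<open>ssd_point_iff_functionals\<close>. The functionals in the dual ball of the projective
  tensor product are the bilinear forms of norm at most one, and distances agree
  (\<open>functional_of_bounded_bilinear\<close>, \<open>bilinear_norm_of_functional\<close> and
  \<open>bounded_linear_proj_tensor_bound\<close>). So for a convex combination \<open>z = (\<Sum>i. c i *\<^sub>R (x i \<otimes>\<^sub>\<pi> y i))\<close> with
  positive weights, condition (2) differs from the criterion for \<open>z\<close> only in asking for
  \<open>B (x i) (y i)\<close> to be close to \<open>1\<close> for each \<open>i\<close>, instead of the average \<open>(\<Sum>i. c i * B (x i) (y i))\<close>. Since each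
  value is at most \<open>1\<close> and the weights are positive, the two requirements are equivalent up to a
  factor depending on the weights (\<open>convex_combination_gt\<close>). The equal weights suffice to get from
  (1) to (2), and (2) gives back (1) for all positive weights.

  Both halves of the criterion compare a functional with the one-sided derivative \<open>norm_deriv z\<close> of
  the norm at \<open>z\<close>, a sublinear function whose linear minorants are exactly the \<open>g\<close> in the dual ball
  with \<open>g z = 1\<close>. If the derivative exists uniformly and \<open>f z\<close> is close to \<open>1\<close>, then
  \<open>f h \<le> norm_deriv z h + \<epsilon> * norm h\<close>, and a Hahn--Banach sandwich splits \<open>f\<close> as a minorant of
  \<open>norm_deriv z\<close> plus a functional of norm at most \<open>\<epsilon>\<close>. Conversely, a functional norming
  \<open>z + t *\<^sub>R h\<close> bounds the difference quotient, and it is within \<open>\<epsilon>\<close> of a minorant of the derivative.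
\<close>

section \<open>Splitting a functional below a sum of sublinear functions\<close>

lemma sublinear_norm: "0 \<le> r \<Longrightarrow> sublinear (\<lambda>x. r * norm x)"
  by (auto simp: sublinear_def distrib_left[symmetric] norm_triangle_ineq mult_left_mono)

text \<open>
  Every \<open>g\<close> as required lies below the function \<open>r\<close> of the proof: the two required inequalities give \<open>g (w + T v) \<le> p (w + T v)\<close> and \<open>- g (T v) \<le> q v - f v\<close>, so \<open>g w\<close> is at most
  every \<open>p (w + T v) + q v - f v\<close>. The hypothesis on \<open>f\<close> keeps the infimum finite. With \<open>T\<close> the
  identity this splits \<open>f\<close> between \<open>p\<close> and \<open>q\<close>; with \<open>q = 0\<close> it extends \<open>f\<close> along \<open>T\<close> under the bound \<open>p\<close>.
\<close>

lemma sandwich_linear: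
  fixes T :: "'v::real_vector \<Rightarrow> 'w::real_vector"
  assumes T: "linear T" and f: "linear f" and p: "sublinear p" and q: "sublinear q"
    and le: "\<And>v. f v \<le> p (T v) + q v"
  shows "\<exists>g. linear g \<and> (\<forall>w. g w \<le> p w) \<and> (\<forall>v. f v - g (T v) \<le> q v)"
proof -
  define r where "r = (\<lambda>w. INF v. p (w + T v) + q v - f v)"
  have bdd: "bdd_below (range (\<lambda>v. p (w + T v) + q v - f v))" for w
  proof (rule bdd_belowI2)
    fix v
    have "p (T v) \<le> p (w + T v) + p (- w)"
      using sublinear_add[OF p, of "w + T v" "- w"] by simp
    then show "- p (- w) \<le> p (w + T v) + q v - f v" using le[of v] by linarith
  qed
  have lower: "r w \<le> p (w + T v) + q v - f v" for w v
    unfolding r_def by (rule cINF_lower[OF bdd]) auto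
  have greatest: "c \<le> r w" if "\<And>v. c \<le> p (w + T v) + q v - f v" for c w
    unfolding r_def by (rule cINF_greatest) (use that in auto)
  have "r (w + w') \<le> r w + r w'" for w w'
  proof -
    have *: "r (w + w') \<le> (p (w + T v) + q v - f v) + (p (w' + T v') + q v' - f v')" for v v'
    proof -
      have "p (w + w' + T (v + v')) \<le> p (w + T v) + p (w' + T v')"
        using sublinear_add[OF p, of "w + T v" "w' + T v'"]
        by (simp add: linear_add[OF T] algebra_simps)
      then show ?thesis
        using lower[of "w + w'" "v + v'"] sublinear_add[OF q, of v v']
        by (simp add: linear_add[OF f])
    qed
    have "r (w + w') - (p (w' + T v') + q v' - f v') \<le> r w" for v'
      by (rule greatest) (use *[of _ v'] in \<open>simp add: algebra_simps\<close>)
    then have "r (w + w') - r w \<le> r w'"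
      by (intro greatest) (simp add: algebra_simps)
    then show ?thesis by simp
  qed
  moreover have "r (a *\<^sub>R w) \<le> a * r w" if "0 \<le> a" for a w
  proof (cases "a = 0")
    case True
    then show ?thesis
      using lower[of 0 0] by (simp add: linear_0[OF T] linear_0[OF f] sublinear_zero p q)
  next
    case False
    then have a: "a > 0" using that by simp
    have "r (a *\<^sub>R w) / a \<le> r w"
    proof (rule greatest)
      fix v
      have "p (a *\<^sub>R w + T (a *\<^sub>R v)) = a * p (w + T v)"
        using sublinear_scale[OF p that, of "w + T v"]
        by (simp add: linear_scale[OF T] scaleR_add_right)
      then have "r (a *\<^sub>R w) \<le> a * (p (w + T v) + q v - f v)"
        using lower[of "a *\<^sub>R w" "a *\<^sub>R v"] sublinear_scale[OF q that, of v]
        by (simp add: linear_scale[OF f] algebra_simps)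
      then show "r (a *\<^sub>R w) / a \<le> p (w + T v) + q v - f v"
        using a by (simp add: field_simps)
    qed
    then show ?thesis using a by (simp add: field_simps)
  qed
  ultimately have "sublinear r" by (simp add: sublinear_def)
  then obtain g where g: "linear g" "g \<le> r" using hahn_banach_sublinear by blast
  \<comment> \<open>The choices \<open>v = 0\<close> and \<open>w = - T v\<close> in the infimum give back the two inequalities.\<close>
  have "g w \<le> p w" for w
    using le_funD[OF g(2), of w] lower[of w 0]
    by (simp add: linear_0[OF T] linear_0[OF f] sublinear_zero[OF q])
  moreover have "f v - g (T v) \<le> q v" for v
    using le_funD[OF g(2), of "- T v"] lower[of "- T v" v]
    by (simp add: linear_neg[OF g(1)] sublinear_zero[OF p])
  ultimately show ?thesis using g(1) by blast
qed

definition unit_functional :: "('a::real_normed_vector \<Rightarrow> real) \<Rightarrow> bool" where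
  "unit_functional f \<longleftrightarrow> linear f \<and> (\<forall>w. \<bar>f w\<bar> \<le> norm w)"

lemma linear_abs_le:
  assumes "linear f" "\<And>w. f w \<le> r * norm w"
  shows "\<bar>f w\<bar> \<le> r * norm w"
  using assms(2)[of w] assms(2)[of "- w"] linear_neg[OF assms(1), of w] by (simp add: abs_le_iff)

lemma unit_functionalI: "linear f \<Longrightarrow> (\<And>w. f w \<le> norm w) \<Longrightarrow> unit_functional f"
  using linear_abs_le[of f 1] by (simp add: unit_functional_def)

lemma unit_functional_le: "unit_functional f \<Longrightarrow> f w \<le> norm w"
  by (auto simp: unit_functional_def dest: spec[of _ w])

section \<open>The one-sided derivative of the norm\<close>

definition norm_quotient :: "'a::real_normed_vector \<Rightarrow> 'a \<Rightarrow> real \<Rightarrow> real" where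
  "norm_quotient z h t = (norm (z + t *\<^sub>R h) - 1) / t"

text \<open>
  The quotients decrease as \<open>t\<close> decreases to \<open>0\<close> when \<open>norm z = 1\<close>, so their infimum is their limit.
\<close>

definition norm_deriv :: "'a::real_normed_vector \<Rightarrow> 'a \<Rightarrow> real" where
  "norm_deriv z h = (INF t\<in>{0<..}. norm_quotient z h t)"

context
  fixes z :: "'a::real_normed_vector"
  assumes z: "norm z = 1"
begin

lemma norm_quotient_mono:
  assumes "0 < t" "t \<le> s"
  shows "norm_quotient z h t \<le> norm_quotient z h s"
proof -
  have "z + t *\<^sub>R h = (1 - t / s) *\<^sub>R z + (t / s) *\<^sub>R (z + s *\<^sub>R h)"
    using assms by (simp add: algebra_simps)
  then have "norm (z + t *\<^sub>R h) \<le> (1 - t / s) + (t / s) * norm (z + s *\<^sub>R h)"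
    using norm_triangle_ineq[of "(1 - t / s) *\<^sub>R z" "(t / s) *\<^sub>R (z + s *\<^sub>R h)"] assms z by simp
  then have "norm (z + t *\<^sub>R h) - 1 \<le> (t / s) * (norm (z + s *\<^sub>R h) - 1)"
    by (simp add: algebra_simps)
  then have "(norm (z + t *\<^sub>R h) - 1) / t \<le> (t / s) * (norm (z + s *\<^sub>R h) - 1) / t"
    using assms by (intro divide_right_mono) auto
  then show ?thesis using assms by (simp add: norm_quotient_def)
qed

text \<open>
  The convexity inequality behind subadditivity of the derivative: with \<open>a = t / (s + t)\<close>, the vector
  \<open>z + (s * t / (s + t)) *\<^sub>R (h + k)\<close> is the convex combination of \<open>z + s *\<^sub>R h\<close> and \<open>z + t *\<^sub>R k\<close> with
  weights \<open>a\<close> and \<open>1 - a\<close>. Step sizes \<open>s\<close> and \<open>t\<close> are independent, so that the infimum can be taken over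
  each separately.
\<close>

lemma norm_quotient_add:
  assumes "0 < s" "0 < t"
  shows "norm_quotient z (h + k) (s * t / (s + t)) \<le> norm_quotient z h s + norm_quotient z k t"
proof -
  define a where "a = t / (s + t)"
  have a: "0 < a" "a < 1" "s * t / (s + t) = a * s" "a * s = (1 - a) * t"
    using assms by (auto simp: a_def field_simps)
  have "z + (a * s) *\<^sub>R (h + k) = z + (a * s) *\<^sub>R h + ((1 - a) * t) *\<^sub>R k"
    using a(4) by (simp add: scaleR_add_right)
  also have "\<dots> = a *\<^sub>R (z + s *\<^sub>R h) + (1 - a) *\<^sub>R (z + t *\<^sub>R k)"
    by (simp add: algebra_simps)
  finally have "norm (z + (a * s) *\<^sub>R (h + k)) \<le> a * norm (z + s *\<^sub>R h) + (1 - a) * norm (z + t *\<^sub>R k)"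
    using norm_triangle_ineq[of "a *\<^sub>R (z + s *\<^sub>R h)" "(1 - a) *\<^sub>R (z + t *\<^sub>R k)"] a by simp
  then have "norm (z + (a * s) *\<^sub>R (h + k)) - 1 \<le> a * (norm (z + s *\<^sub>R h) - 1) + (1 - a) * (norm (z + t *\<^sub>R k) - 1)"
    by (simp add: algebra_simps)
  then have "(norm (z + (a * s) *\<^sub>R (h + k)) - 1) / (a * s) \<le>
      (a * (norm (z + s *\<^sub>R h) - 1) + (1 - a) * (norm (z + t *\<^sub>R k) - 1)) / (a * s)"
    using a assms by (intro divide_right_mono) auto
  also have "\<dots> = a * (norm (z + s *\<^sub>R h) - 1) / (a * s) + (1 - a) * (norm (z + t *\<^sub>R k) - 1) / ((1 - a) * t)"
    by (simp only: add_divide_distrib a(4))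
  also have "\<dots> = norm_quotient z h s + norm_quotient z k t"
    using a(1,2) by (simp add: norm_quotient_def)
  finally show ?thesis using a(3) by (simp add: norm_quotient_def)
qed

lemma norm_quotient_ge: "0 < t \<Longrightarrow> - norm h \<le> norm_quotient z h t"
  using norm_triangle_ineq2[of z "- (t *\<^sub>R h)"] z by (simp add: norm_quotient_def field_simps)

lemma norm_quotient_le: "0 < t \<Longrightarrow> norm_quotient z h t \<le> norm h"
  using norm_triangle_ineq[of z "t *\<^sub>R h"] z by (simp add: norm_quotient_def field_simps)

lemma norm_deriv_le: "0 < t \<Longrightarrow> norm_deriv z h \<le> norm_quotient z h t"
  unfolding norm_deriv_def
  by (rule cINF_lower) (auto intro: bdd_belowI2[of _ "- norm h"] norm_quotient_ge)

lemma norm_deriv_greatest: "(\<And>t. 0 < t \<Longrightarrow> c \<le> norm_quotient z h t) \<Longrightarrow> c \<le> norm_deriv z h"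
  unfolding norm_deriv_def by (rule cINF_greatest) auto

lemma sublinear_norm_deriv: "sublinear (norm_deriv z)"
  unfolding sublinear_def
proof (intro conjI allI impI)
  fix h k
  have *: "norm_deriv z (h + k) \<le> norm_quotient z h s + norm_quotient z k t" if "0 < s" "0 < t" for s t
    using norm_quotient_add[OF that] norm_deriv_le[of "s * t / (s + t)" "h + k"] that
    by (meson add_pos_pos divide_pos_pos mult_pos_pos order_trans)
  have "norm_deriv z (h + k) - norm_quotient z k t \<le> norm_deriv z h" if "0 < t" for t
    by (rule norm_deriv_greatest) (use *[OF _ that] in \<open>simp add: algebra_simps\<close>)
  then have "norm_deriv z (h + k) - norm_deriv z h \<le> norm_deriv z k"
    by (intro norm_deriv_greatest) (simp add: algebra_simps)
  then show "norm_deriv z (h + k) \<le> norm_deriv z h + norm_deriv z k" by simp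
next
  fix r :: real and h assume "0 \<le> r"
  show "norm_deriv z (r *\<^sub>R h) \<le> r * norm_deriv z h"
  proof (cases "r = 0")
    case True
    then show ?thesis using norm_deriv_le[of 1 0] z by (simp add: norm_quotient_def)
  next
    case False
    then have r: "0 < r" using \<open>0 \<le> r\<close> by simp
    have "norm_deriv z (r *\<^sub>R h) / r \<le> norm_deriv z h"
    proof (rule norm_deriv_greatest)
      fix t :: real assume t: "0 < t"
      then have "norm_deriv z (r *\<^sub>R h) \<le> r * norm_quotient z h t"
        using norm_deriv_le[of "t / r" "r *\<^sub>R h"] r by (simp add: norm_quotient_def field_simps)
      then show "norm_deriv z (r *\<^sub>R h) / r \<le> norm_quotient z h t"
        using r by (simp add: field_simps)
    qed
    then show ?thesis using r by (simp add: field_simps)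
  qed
qed

text \<open>
  By monotonicity of the quotients, uniformity needs to be tested at a single step size \<open>t\<close> for each
  \<open>\<epsilon>\<close>, and the uniform limit can only be \<open>norm_deriv z\<close>.
\<close>

lemma ssd_point_iff_norm_deriv:
  "ssd_point z \<longleftrightarrow>
    (\<forall>\<epsilon>>0. \<exists>t>0. \<forall>h\<in>sphere 0 1. norm_quotient z h t \<le> norm_deriv z h + \<epsilon>)"
proof
  assume "ssd_point z"
  then obtain l where l: "uniform_limit (sphere 0 1) (\<lambda>t h. norm_quotient z h t) l (at_right 0)"
    by (auto simp: ssd_point_def norm_quotient_def)
  show "\<forall>\<epsilon>>0. \<exists>t>0. \<forall>h\<in>sphere 0 1. norm_quotient z h t \<le> norm_deriv z h + \<epsilon>"
  proof (intro allI impI)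
    fix \<epsilon> :: real assume "0 < \<epsilon>"
    then have "\<forall>\<^sub>F t in at_right 0. \<forall>h\<in>sphere 0 1. dist (norm_quotient z h t) (l h) < \<epsilon> / 2"
      using uniform_limitD[OF l, of "\<epsilon> / 2"] by simp
    then obtain b where b: "0 < b"
      "\<And>t h. 0 < t \<Longrightarrow> t < b \<Longrightarrow> h \<in> sphere 0 1 \<Longrightarrow> dist (norm_quotient z h t) (l h) < \<epsilon> / 2"
      unfolding eventually_at_right_field by auto
    have "norm_quotient z h (b / 2) - \<epsilon> \<le> norm_deriv z h" if h: "h \<in> sphere 0 1" for h
    \<comment> \<open>Quotients at steps below \<open>b\<close> are within \<open>\<epsilon>\<close> of each other, and passing to a smaller step only
      decreases them; hence comparison with the step \<open>min t (b / 2)\<close>.\<close>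
    proof (rule norm_deriv_greatest)
      fix t :: real assume t: "0 < t"
      have "dist (norm_quotient z h (b / 2)) (l h) < \<epsilon> / 2"
        "dist (norm_quotient z h (min t (b / 2))) (l h) < \<epsilon> / 2"
        using b t h by auto
      moreover have "norm_quotient z h (min t (b / 2)) \<le> norm_quotient z h t"
        using t b by (intro norm_quotient_mono) auto
      ultimately show "norm_quotient z h (b / 2) - \<epsilon> \<le> norm_quotient z h t"
        unfolding dist_real_def by linarith
    qed
    then show "\<exists>t>0. \<forall>h\<in>sphere 0 1. norm_quotient z h t \<le> norm_deriv z h + \<epsilon>"
      using b(1) by (intro exI[of _ "b / 2"]) (auto simp: algebra_simps)
  qed
next
  assume R: "\<forall>\<epsilon>>0. \<exists>t>0. \<forall>h\<in>sphere 0 1. norm_quotient z h t \<le> norm_deriv z h + \<epsilon>"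
  have "uniform_limit (sphere 0 1) (\<lambda>t h. norm_quotient z h t) (norm_deriv z) (at_right 0)"
  proof (rule uniform_limitI)
    fix \<epsilon> :: real assume "0 < \<epsilon>"
    then obtain b where b: "0 < b"
      "\<And>h. h \<in> sphere 0 1 \<Longrightarrow> norm_quotient z h b \<le> norm_deriv z h + \<epsilon> / 2"
      using R[rule_format, of "\<epsilon> / 2"] by auto
    have "dist (norm_quotient z h t) (norm_deriv z h) < \<epsilon>"
      if "0 < t" "t < b" "h \<in> sphere 0 1" for t h
      using norm_quotient_mono[of t b h] norm_deriv_le[of t h] b(2)[of h] that \<open>0 < \<epsilon>\<close>
      by (simp add: dist_real_def abs_less_iff)
    then show "\<forall>\<^sub>F t in at_right 0. \<forall>h\<in>sphere 0 1. dist (norm_quotient z h t) (norm_deriv z h) < \<epsilon>"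
      unfolding eventually_at_right_field using b(1) by blast
  qed
  then show "ssd_point z" using z by (auto simp: ssd_point_def norm_quotient_def)
qed

text \<open>
  For \<open>f z = 1\<close> this says that \<open>f\<close> is a subgradient of the norm at \<open>z\<close>; in general \<open>f\<close> is a
  subgradient up to an error which is small once \<open>1 - f z\<close> is small compared with \<open>t\<close>.
\<close>

lemma functional_le_norm_quotient:
  assumes f: "unit_functional f" and t: "0 < t"
  shows "f h \<le> norm_quotient z h t + (1 - f z) / t"
proof -
  have "f (z + t *\<^sub>R h) \<le> norm (z + t *\<^sub>R h)" using f by (rule unit_functional_le)
  then have "t * f h \<le> (norm (z + t *\<^sub>R h) - 1) + (1 - f z)"
    using f by (simp add: unit_functional_def linear_add linear_scale)
  then have "f h \<le> ((norm (z + t *\<^sub>R h) - 1) + (1 - f z)) / t"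
    using t by (simp add: pos_le_divide_eq mult.commute)
  then show ?thesis by (simp only: norm_quotient_def add_divide_distrib)
qed

text \<open>
  The Franchetti--Paya criterion. From left to right, \<open>f\<close> is an approximate subgradient and the
  sandwich replaces it by an exact one. From right to left, a functional norming \<open>z + t *\<^sub>R h\<close> nearly
  norms \<open>z\<close> once \<open>t\<close> is small, by an amount independent of \<open>h\<close>, and an exact subgradient close to it
  controls the quotient at \<open>t\<close>.
\<close>

proposition ssd_point_iff_functionals:
  "ssd_point z \<longleftrightarrow>
    (\<forall>\<epsilon>>0. \<exists>\<eta>>0. \<forall>f. unit_functional f \<and> f z > 1 - \<eta> \<longrightarrow>
       (\<exists>g. unit_functional g \<and> g z = 1 \<and> (\<forall>w. \<bar>f w - g w\<bar> \<le> \<epsilon> * norm w)))"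
  (is "_ \<longleftrightarrow> ?R")
proof
  assume ssd: "ssd_point z"
  show ?R
  proof (intro allI impI)
    fix \<epsilon> :: real assume \<epsilon>: "0 < \<epsilon>"
    then obtain t where t: "0 < t"
      "\<And>h. h \<in> sphere 0 1 \<Longrightarrow> norm_quotient z h t \<le> norm_deriv z h + \<epsilon> / 2"
      using ssd[unfolded ssd_point_iff_norm_deriv, rule_format, of "\<epsilon> / 2"] by auto
    have "\<exists>g. unit_functional g \<and> g z = 1 \<and> (\<forall>w. \<bar>f w - g w\<bar> \<le> \<epsilon> * norm w)"
      if f: "unit_functional f" and fz: "f z > 1 - t * \<epsilon> / 2" for f
    proof -
      have linf: "linear f" using f by (simp add: unit_functional_def)
      have le: "f h \<le> norm_deriv z h + \<epsilon> * norm h" for h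
      proof (cases "h = 0")
        case True
        then show ?thesis
          using linear_0[OF linf] sublinear_zero[OF sublinear_norm_deriv] by simp
      next
        case False
        define u where "u = h /\<^sub>R norm h"
        have u: "u \<in> sphere 0 1" "h = norm h *\<^sub>R u" using False by (auto simp: u_def)
        have "(1 - f z) / t \<le> \<epsilon> / 2" using fz t(1) by (simp add: field_simps)
        then have "f u \<le> norm_deriv z u + \<epsilon>"
          using functional_le_norm_quotient[OF f t(1), of u] t(2)[OF u(1)] by linarith
        then have "norm h * f u \<le> norm h * (norm_deriv z u + \<epsilon>)"
          by (rule mult_left_mono) simp
        then show ?thesis
          using linear_scale[OF linf, of "norm h" u] u(2)
            sublinear_scale[OF sublinear_norm_deriv norm_ge_zero, of h u]
          by (simp add: algebra_simps)
      qed
      obtain g where g: "linear g" "\<And>w. g w \<le> norm_deriv z w" "\<And>w. f w - g w \<le> \<epsilon> * norm w"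
        using sandwich_linear[OF linear_id linf sublinear_norm_deriv sublinear_norm[of \<epsilon>]] le \<epsilon>
        by auto
      have unit: "unit_functional g"
      proof (rule unit_functionalI[OF g(1)])
        show "g w \<le> norm w" for w
          using g(2)[of w] norm_deriv_le[of 1 w] norm_quotient_le[of 1 w] by simp
      qed
      \<comment> \<open>Along \<open>- z\<close> the norm decreases linearly, so minorants of the derivative are at least \<open>1\<close> at \<open>z\<close>.\<close>
      have "norm_quotient z (- z) (1 / 2) = -1"
        using z scaleR_left_diff_distrib[of 1 "1/2" z, symmetric] by (simp add: norm_quotient_def)
      then have "g z \<ge> 1"
        using g(2)[of "- z"] norm_deriv_le[of "1/2" "- z"] linear_neg[OF g(1), of z] by simp
      moreover have "g z \<le> 1" using unit_functional_le[OF unit, of z] z by simp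
      moreover have "\<bar>f w - g w\<bar> \<le> \<epsilon> * norm w" for w
        using linear_abs_le[OF linear_compose_sub[OF linf g(1)] g(3)] .
      ultimately show ?thesis using unit by (intro exI[of _ g]) auto
    qed
    then show "\<exists>\<eta>>0. \<forall>f. unit_functional f \<and> f z > 1 - \<eta> \<longrightarrow>
       (\<exists>g. unit_functional g \<and> g z = 1 \<and> (\<forall>w. \<bar>f w - g w\<bar> \<le> \<epsilon> * norm w))"
      using t(1) \<epsilon> by (intro exI[of _ "t * \<epsilon> / 2"]) auto
  qed
next
  assume R: ?R
  show "ssd_point z"
    unfolding ssd_point_iff_norm_deriv
  proof (intro allI impI)
    fix \<epsilon> :: real assume \<epsilon>: "0 < \<epsilon>"
    then obtain \<eta> where \<eta>: "0 < \<eta>" "\<And>f. unit_functional f \<Longrightarrow> f z > 1 - \<eta> \<Longrightarrow>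
       \<exists>g. unit_functional g \<and> g z = 1 \<and> (\<forall>w. \<bar>f w - g w\<bar> \<le> \<epsilon> * norm w)"
      using R by blast
    \<comment> \<open>A functional norming \<open>z + t *\<^sub>R h\<close> has value at least \<open>1 - 2 * t\<close> at \<open>z\<close>, which has to exceed \<open>1 - \<eta>\<close>.\<close>
    define t where "t = \<eta> / 3"
    have t: "0 < t" using \<eta>(1) by (simp add: t_def)
    have "norm_quotient z h t \<le> norm_deriv z h + \<epsilon>" if h: "h \<in> sphere 0 1" for h
    proof -
      obtain f where "bounded_linear f" "\<forall>w. \<bar>f w\<bar> \<le> norm w" and fh: "f (z + t *\<^sub>R h) = norm (z + t *\<^sub>R h)"
        using norming_functional by blast
      then have f: "unit_functional f" by (simp add: unit_functional_def bounded_linear.linear)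
      then have eq: "f z + t * f h = norm (z + t *\<^sub>R h)"
        using fh by (simp add: unit_functional_def linear_add linear_scale)
      have fh1: "f h \<le> 1" and fz1: "f z \<le> 1"
        using unit_functional_le[OF f, of h] unit_functional_le[OF f, of z] h z by simp_all
      have "norm (z + t *\<^sub>R h) \<ge> 1 - t"
        using norm_triangle_ineq2[of z "- (t *\<^sub>R h)"] z h t by simp
      moreover have "t * f h \<le> t" using fh1 t by simp
      ultimately have "f z \<ge> 1 - 2 * t" using eq by linarith
      then have "f z > 1 - \<eta>" using \<eta>(1) by (simp add: t_def)
      then obtain g where g: "unit_functional g" "g z = 1" "\<And>w. \<bar>f w - g w\<bar> \<le> \<epsilon> * norm w"
        using \<eta>(2)[OF f] by blast
      have "norm_quotient z h t \<le> f h"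
        using eq fz1 t by (simp add: norm_quotient_def field_simps)
      also have "f h \<le> g h + \<epsilon>" using g(3)[of h] h by (simp add: abs_le_iff)
      also have "g h \<le> norm_deriv z h"
        using functional_le_norm_quotient[OF g(1)] g(2) by (intro norm_deriv_greatest) simp
      finally show ?thesis by simp
    qed
    then show "\<exists>t>0. \<forall>h\<in>sphere 0 1. norm_quotient z h t \<le> norm_deriv z h + \<epsilon>"
      using t by blast
  qed
qed

end

section \<open>Bilinear forms as functionals on the projective tensor product\<close>

lemma bilinear_norm_le:
  assumes "0 \<le> C" "\<And>x y. \<bar>B x y\<bar> \<le> C * (norm x * norm y)"
  shows "bilinear_norm B \<le> C"
  unfolding bilinear_norm_def
proof (rule cSUP_least)
  fix p assume "p \<in> cball (0::'a) 1 \<times> cball (0::'b) 1"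
  then obtain x y where p: "p = (x, y)" "norm x \<le> 1" "norm y \<le> 1" by auto
  then have "C * (norm x * norm y) \<le> C * 1"
    using assms(1) by (intro mult_left_mono mult_le_one) auto
  then show "(case p of (x, y) \<Rightarrow> \<bar>B x y\<bar>) \<le> C" using assms(2)[of x y] p(1) by simp
qed auto

lemma bilinear_norm_ge:
  assumes B: "bounded_bilinear B"
  shows "\<bar>B x y\<bar> \<le> bilinear_norm B * (norm x * norm y)"
proof -
  interpret bounded_bilinear B by (rule B)
  obtain K where K: "0 < K" "\<And>x y. norm (B x y) \<le> norm x * norm y * K"
    using pos_bounded by blast
  have ball: "\<bar>B x y\<bar> \<le> bilinear_norm B" if "norm x \<le> 1" "norm y \<le> 1" for x y
  proof -
    have "(case (x, y) of (x, y) \<Rightarrow> \<bar>B x y\<bar>) \<le> bilinear_norm B"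
      unfolding bilinear_norm_def
    proof (rule cSUP_upper)
      show "bdd_above ((\<lambda>(x, y). \<bar>B x y\<bar>) ` (cball 0 1 \<times> cball 0 1))"
      proof (rule bdd_aboveI2)
        fix p assume "p \<in> cball (0::'a) 1 \<times> cball (0::'b) 1"
        then obtain x y where p: "p = (x, y)" "norm x \<le> 1" "norm y \<le> 1" by auto
        then have "norm x * norm y * K \<le> 1 * K"
          using K(1) by (intro mult_right_mono mult_le_one) auto
        then show "(case p of (x, y) \<Rightarrow> \<bar>B x y\<bar>) \<le> K" using K(2)[of x y] p(1) by simp
      qed
    qed (use that in auto)
    then show ?thesis by simp
  qed
  show ?thesis
  proof (cases "x = 0 \<or> y = 0")
    case True
    then show ?thesis by (auto simp: zero_left zero_right)
  next
    case False
    have "\<bar>B (x /\<^sub>R norm x) (y /\<^sub>R norm y)\<bar> \<le> bilinear_norm B"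
      using False by (intro ball) auto
    then show ?thesis
      using False by (simp add: scaleR_left scaleR_right abs_mult field_simps)
  qed
qed

lemma bounded_bilinear_diff:
  assumes "bounded_bilinear B" "bounded_bilinear B'"
  shows "bounded_bilinear (\<lambda>x y. B x y - B' x y)"
proof -
  interpret B: bounded_bilinear B by fact
  interpret B': bounded_bilinear B' by fact
  obtain K K' where K: "\<And>x y. norm (B x y) \<le> norm x * norm y * K"
    "\<And>x y. norm (B' x y) \<le> norm x * norm y * K'"
    using B.bounded B'.bounded by blast
  show ?thesis
  proof
    have "norm (B x y - B' x y) \<le> norm x * norm y * (K + K')" for x y
      using norm_triangle_ineq4[of "B x y" "B' x y"] K[of x y] by (simp add: distrib_left)
    then show "\<exists>K. \<forall>x y. norm (B x y - B' x y) \<le> norm x * norm y * K" by blast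
  qed (simp_all add: B.add_left B'.add_left B.add_right B'.add_right B.scaleR_left B'.scaleR_left
      B.scaleR_right B'.scaleR_right scaleR_diff_right)
qed

text \<open>
  On the algebraic tensor product the projective norm is designed so that a bound on elementary
  tensors is a bound everywhere; density carries it to the completion.
\<close>

lemma bounded_linear_proj_tensor_bound:
  fixes L :: "('a::real_normed_vector, 'b::real_normed_vector) proj_tensor \<Rightarrow> real"
  assumes L: "bounded_linear L" and C: "0 \<le> C" "\<And>x y. \<bar>L (x \<otimes>\<^sub>\<pi> y)\<bar> \<le> C * (norm x * norm y)"
  shows "\<bar>L w\<bar> \<le> C * norm w"
proof -
  let ?S = "{w. \<bar>L w\<bar> \<le> C * norm w}"
  have "closed ?S"
    by (intro closed_Collect_le continuous_intros linear_continuous_on[OF L])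
  moreover have "range to_completion \<subseteq> ?S"
  proof clarify
    fix v :: "('a, 'b) tensor"
    have "linear (L \<circ> to_completion)"
      using linear_compose[OF linear_to_completion bounded_linear.linear[OF L]] .
    from tensor_functional_le[OF this C(1), of v] C(2)
    show "\<bar>L (to_completion v)\<bar> \<le> C * norm (to_completion v)"
      by (simp add: proj_tensor_of_def norm_to_completion)
  qed
  ultimately have "closure (range to_completion) \<subseteq> ?S" by (rule closure_minimal[rotated])
  then show ?thesis by (auto simp: to_completion_dense)
qed

lemma norm_proj_tensor_of_le: "norm (x \<otimes>\<^sub>\<pi> y) \<le> norm x * norm y"
  using tensor_norm_le[where z = "tensor_of x y" and k = "Suc 0" and x = "\<lambda>_. x" and y = "\<lambda>_. y"]
  by (simp add: proj_tensor_of_def norm_to_completion)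

lemma bounded_bilinear_of_functional:
  assumes f: "unit_functional f"
  shows "bounded_bilinear (\<lambda>x y. f (x \<otimes>\<^sub>\<pi> y))"
proof -
  have lin: "linear f" using f by (simp add: unit_functional_def)
  note simps = proj_tensor_of_def linear_add[OF lin] linear_scale[OF lin]
    linear_add[OF linear_to_completion] linear_scale[OF linear_to_completion]
    bilinear_ladd[OF bilinear_tensor_of] bilinear_radd[OF bilinear_tensor_of]
    bilinear_lmul[OF bilinear_tensor_of] bilinear_rmul[OF bilinear_tensor_of]
  show ?thesis
  proof
    show "\<exists>K. \<forall>a b. norm (f (a \<otimes>\<^sub>\<pi> b)) \<le> norm a * norm b * K"
      using f norm_proj_tensor_of_le order_trans
      by (intro exI[of _ 1]) (fastforce simp: unit_functional_def)
  qed (simp_all add: simps)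
qed

lemma bilinear_norm_of_functional:
  "unit_functional f \<Longrightarrow> bilinear_norm (\<lambda>x y. f (x \<otimes>\<^sub>\<pi> y)) \<le> 1"
  using norm_proj_tensor_of_le order_trans
  by (intro bilinear_norm_le) (fastforce simp: unit_functional_def)+

text \<open>
  The universal property gives the functional on the algebraic tensor product. The sandwich with
  \<open>q = 0\<close> extends it along \<open>to_completion\<close> without increasing its norm: the error
  \<open>L v - f (to_completion v)\<close> is linear and nonpositive, hence zero.
\<close>

lemma functional_of_bounded_bilinear:
  assumes B: "bounded_bilinear B" and le: "bilinear_norm B \<le> 1"
  shows "\<exists>f. unit_functional f \<and> (\<forall>x y. f (x \<otimes>\<^sub>\<pi> y) = B x y)"
proof -
  have "bilinear B"
    unfolding bilinear_def
    using bounded_bilinear.bounded_linear_left[OF B] bounded_bilinear.bounded_linear_right[OF B]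
    by (auto intro: bounded_linear.linear)
  then obtain L where L: "linear L" "\<And>x y. L (tensor_of x y) = B x y"
    using tensor_universal by blast
  have "\<bar>B x y\<bar> \<le> 1 * (norm x * norm y)" for x y
    using bilinear_norm_ge[OF B, of x y] le
    by (meson mult_nonneg_nonneg mult_right_mono norm_ge_zero order_trans)
  then have "\<bar>L v\<bar> \<le> norm v" for v
    using tensor_functional_le[OF L(1), of 1 v] L(2) by simp
  then have "L v \<le> 1 * norm (to_completion v) + 0" for v
    by (simp add: norm_to_completion abs_le_iff)
  moreover have "sublinear (\<lambda>_. 0)" by (simp add: sublinear_def)
  ultimately obtain f where f: "linear f" "\<And>w. f w \<le> 1 * norm w" "\<And>v. L v - f (to_completion v) \<le> 0"
    using sandwich_linear[OF linear_to_completion L(1) sublinear_norm[of 1], of "\<lambda>_. 0"] by auto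
  have "f (to_completion v) = L v" for v
    using f(3)[of v] f(3)[of "- v"]
    by (simp add: linear_neg[OF L(1)] linear_neg[OF f(1)] linear_neg[OF linear_to_completion])
  then show ?thesis
    using f L(2) by (intro exI[of _ f]) (simp add: proj_tensor_of_def unit_functionalI)
qed

section \<open>Averages of numbers at most one\<close>

text \<open>
  The deficits \<open>1 - b i\<close> are nonnegative, so the single term \<open>c j * (1 - b j)\<close> is at most the deficit of
  the average.
\<close>

lemma convex_combination_gt:
  fixes b c :: "'i \<Rightarrow> real"
  assumes "finite I" "j \<in> I" and c: "\<And>i. i \<in> I \<Longrightarrow> 0 < c i" "sum c I = 1"
    and b: "\<And>i. i \<in> I \<Longrightarrow> b i \<le> 1"
    and gt: "(\<Sum>i\<in>I. c i * b i) > 1 - c j * \<eta>"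
  shows "b j > 1 - \<eta>"
proof -
  have "c j * (1 - b j) \<le> (\<Sum>i\<in>I. c i * (1 - b i))"
    using assms by (intro member_le_sum) (auto simp: less_imp_le)
  also have "\<dots> = 1 - (\<Sum>i\<in>I. c i * b i)"
    using c(2) by (simp add: right_diff_distrib sum_subtractf)
  also have "\<dots> < c j * \<eta>" using gt by simp
  finally show ?thesis using c(1)[OF assms(2)] by simp
qed

lemma convex_combination_eq_1:
  fixes b c :: "'i \<Rightarrow> real"
  assumes "finite I" "j \<in> I" and "\<And>i. i \<in> I \<Longrightarrow> 0 < c i" "sum c I = 1"
    and "\<And>i. i \<in> I \<Longrightarrow> b i \<le> 1" and "(\<Sum>i\<in>I. c i * b i) = 1"
  shows "b j = 1"
proof (rule antisym)
  show "1 \<le> b j"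
  proof (rule field_le_epsilon)
    fix e :: real assume "0 < e"
    then show "1 \<le> b j + e"
      using convex_combination_gt[of I j c b e] assms by simp
  qed
qed (use assms in auto)

section \<open>Approximation of bilinear forms and SSD points\<close>

theorem theorem3p9:
  fixes x :: "nat \<Rightarrow> 'a::banach" and y :: "nat \<Rightarrow> 'b::banach" and n :: nat
  assumes "n \<ge> 1"
    and "\<And>i. i \<in> {1..n} \<Longrightarrow> x i \<in> sphere 0 1"
    and "\<And>i. i \<in> {1..n} \<Longrightarrow> y i \<in> sphere 0 1"
  shows
    "((1 / real n) * norm (\<Sum>i=1..n. x i \<otimes>\<^sub>\<pi> y i) = 1 \<longleftrightarrow>
        (\<exists>V. bounded_bilinear V \<and> bilinear_norm V = 1 \<and> (\<forall>i\<in>{1..n}. V (x i) (y i) = 1)))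
     \<and>
     ((1 / real n) * norm (\<Sum>i=1..n. x i \<otimes>\<^sub>\<pi> y i) = 1 \<longrightarrow>
        ((\<forall>c::nat \<Rightarrow> real.
            (\<forall>i\<in>{1..n}. c i \<in> {0<..1}) \<and> (\<Sum>i=1..n. c i) = 1 \<longrightarrow>
            ssd_point (\<Sum>i=1..n. c i *\<^sub>R (x i \<otimes>\<^sub>\<pi> y i)))
         \<longleftrightarrow>
         (\<forall>\<epsilon>>0. \<exists>\<eta>>0. \<forall>B.
            bounded_bilinear B \<and> bilinear_norm B \<le> 1 \<and> (\<forall>i\<in>{1..n}. B (x i) (y i) > 1 - \<eta>) \<longrightarrow>
            (\<exists>B'. bounded_bilinear B' \<and> bilinear_norm B' = 1 \<and>
                  (\<forall>i\<in>{1..n}. B' (x i) (y i) = 1) \<and>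
                  bilinear_norm (\<lambda>u v. B u v - B' u v) < \<epsilon>))))"
    (is "(?avg = 1 \<longleftrightarrow> ?V) \<and> (?avg = 1 \<longrightarrow> (?ssd \<longleftrightarrow> ?approx))")
proof -
  let ?I = "{1..n}"
  define z where "z = (\<lambda>c::nat \<Rightarrow> real. \<Sum>i=1..n. c i *\<^sub>R (x i \<otimes>\<^sub>\<pi> y i))"
  define weights where "weights = (\<lambda>c::nat \<Rightarrow> real. (\<forall>i\<in>?I. 0 < c i) \<and> sum c ?I = 1)"
  have nx: "norm (x i) = 1" and ny: "norm (y i) = 1" if "i \<in> ?I" for i
    using assms(2,3) that by auto
  have le1: "f (x i \<otimes>\<^sub>\<pi> y i) \<le> 1" if "unit_functional f" "i \<in> ?I" for f i
    using unit_functional_le[OF that(1), of "x i \<otimes>\<^sub>\<pi> y i"]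
      norm_proj_tensor_of_le[of "x i" "y i"] nx[OF that(2)] ny[OF that(2)] by simp
  have fz: "f (z c) = (\<Sum>i\<in>?I. c i * f (x i \<otimes>\<^sub>\<pi> y i))" if "unit_functional f" for f c
    using that by (simp add: z_def unit_functional_def linear_sum linear_scale)
  have all_1: "f (x i \<otimes>\<^sub>\<pi> y i) = 1"
    if "weights c" "unit_functional f" "f (z c) = 1" "i \<in> ?I" for f c i
    using convex_combination_eq_1[of ?I i c "\<lambda>i. f (x i \<otimes>\<^sub>\<pi> y i)"] that fz le1
    by (auto simp: weights_def)
  have z_1: "f (z c) = 1"
    if "weights c" "unit_functional f" "\<And>i. i \<in> ?I \<Longrightarrow> f (x i \<otimes>\<^sub>\<pi> y i) = 1" for f c
    using that by (simp add: fz weights_def)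
  have norm_z_le: "norm (z c) \<le> 1" if "weights c" for c
  proof -
    have "norm (z c) \<le> (\<Sum>i\<in>?I. c i * (norm (x i) * norm (y i)))"
      unfolding z_def using that norm_proj_tensor_of_le
      by (intro sum_norm_le) (auto simp: weights_def less_imp_le intro!: mult_left_mono)
    also have "\<dots> = 1" using that nx ny by (simp add: weights_def)
    finally show ?thesis .
  qed
  have norming: "bounded_bilinear (\<lambda>u v. f (u \<otimes>\<^sub>\<pi> v)) \<and> bilinear_norm (\<lambda>u v. f (u \<otimes>\<^sub>\<pi> v)) = 1"
    if f: "unit_functional f" and 1: "\<And>i. i \<in> ?I \<Longrightarrow> f (x i \<otimes>\<^sub>\<pi> y i) = 1" for f
  proof -
    note bb = bounded_bilinear_of_functional[OF f]
    have "1 \<in> ?I" using assms(1) by simp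
    then have "1 \<le> bilinear_norm (\<lambda>u v. f (u \<otimes>\<^sub>\<pi> v))"
      using bilinear_norm_ge[OF bb, of "x 1" "y 1"] 1[of 1] nx[of 1] ny[of 1] by simp
    then show ?thesis using bb bilinear_norm_of_functional[OF f] by simp
  qed
  define u where "u = (\<lambda>_::nat. 1 / real n)"
  have wu: "weights u" using assms(1) by (simp add: weights_def u_def)
  have "z u = (1 / real n) *\<^sub>R (\<Sum>i=1..n. x i \<otimes>\<^sub>\<pi> y i)"
    by (simp add: z_def u_def scaleR_sum_right)
  then have avg: "?avg = norm (z u)" by simp

  have V: "?avg = 1 \<longleftrightarrow> ?V"
  proof
    assume 1: "?avg = 1"
    obtain f where "bounded_linear f" "\<forall>w. \<bar>f w\<bar> \<le> norm w" and fu: "f (z u) = norm (z u)"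
      using norming_functional by blast
    then have f: "unit_functional f" by (simp add: unit_functional_def bounded_linear.linear)
    have "f (x i \<otimes>\<^sub>\<pi> y i) = 1" if "i \<in> ?I" for i
      using all_1[OF wu f _ that] fu 1 unfolding avg by simp
    then show ?V using norming[OF f] by blast
  next
    assume ?V
    then obtain V where V: "bounded_bilinear V" "bilinear_norm V = 1" "\<forall>i\<in>?I. V (x i) (y i) = 1"
      by blast
    then obtain f where f: "unit_functional f" "\<And>a b. f (a \<otimes>\<^sub>\<pi> b) = V a b"
      using functional_of_bounded_bilinear[OF V(1)] by auto
    have "1 \<le> norm (z u)"
      using z_1[OF wu f(1)] V(3) f(2) unit_functional_le[OF f(1), of "z u"] by simp
    then show "?avg = 1" using norm_z_le[OF wu] unfolding avg by simp
  qed

  have "?ssd \<longleftrightarrow> ?approx" if 1: "?avg = 1"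
  proof
    assume ?ssd
    have "\<forall>i\<in>?I. u i \<in> {0<..1}" using assms(1) by (simp add: u_def)
    moreover have "sum u ?I = 1" using wu by (simp add: weights_def)
    ultimately have "ssd_point (z u)" using \<open>?ssd\<close> unfolding z_def by blast
    moreover have "norm (z u) = 1" using 1 unfolding avg .
    ultimately have S: "\<forall>\<epsilon>>0. \<exists>\<eta>>0. \<forall>f. unit_functional f \<and> f (z u) > 1 - \<eta> \<longrightarrow>
       (\<exists>g. unit_functional g \<and> g (z u) = 1 \<and> (\<forall>w. \<bar>f w - g w\<bar> \<le> \<epsilon> * norm w))"
      using ssd_point_iff_functionals by blast
    show ?approx
    proof (intro allI impI)
      fix \<epsilon> :: real assume \<epsilon>: "0 < \<epsilon>"
      \<comment> \<open>The bound in the criterion is not strict, hence \<open>\<epsilon> / 2\<close>.\<close>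
      then obtain \<eta> where \<eta>: "0 < \<eta>" "\<And>f. unit_functional f \<Longrightarrow> f (z u) > 1 - \<eta> \<Longrightarrow>
         \<exists>g. unit_functional g \<and> g (z u) = 1 \<and> (\<forall>w. \<bar>f w - g w\<bar> \<le> \<epsilon> / 2 * norm w)"
        using S[rule_format, of "\<epsilon> / 2"] by auto
      have "\<exists>B'. bounded_bilinear B' \<and> bilinear_norm B' = 1 \<and>
              (\<forall>i\<in>?I. B' (x i) (y i) = 1) \<and> bilinear_norm (\<lambda>u v. B u v - B' u v) < \<epsilon>"
        if B: "bounded_bilinear B" "bilinear_norm B \<le> 1"
          and gt: "\<And>i. i \<in> ?I \<Longrightarrow> B (x i) (y i) > 1 - \<eta>" for B
      proof -
        obtain f where f: "unit_functional f" "\<And>a b. f (a \<otimes>\<^sub>\<pi> b) = B a b"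
          using functional_of_bounded_bilinear[OF B] by blast
        have "(\<Sum>i\<in>?I. u i * (1 - \<eta>)) < (\<Sum>i\<in>?I. u i * B (x i) (y i))"
          using gt wu assms(1) by (intro sum_strict_mono) (auto simp: weights_def)
        moreover have "(\<Sum>i\<in>?I. u i * (1 - \<eta>)) = 1 - \<eta>"
          using wu by (simp add: weights_def sum_distrib_right[symmetric])
        ultimately have "f (z u) > 1 - \<eta>" by (simp add: fz[OF f(1)] f(2))
        then obtain g where g: "unit_functional g" "g (z u) = 1" "\<And>w. \<bar>f w - g w\<bar> \<le> \<epsilon> / 2 * norm w"
          using \<eta>(2)[OF f(1)] by blast
        have "bilinear_norm (\<lambda>a b. B a b - g (a \<otimes>\<^sub>\<pi> b)) \<le> \<epsilon> / 2"
        proof (rule bilinear_norm_le)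
          fix a :: 'a and b :: 'b
          have "\<epsilon> / 2 * norm (a \<otimes>\<^sub>\<pi> b) \<le> \<epsilon> / 2 * (norm a * norm b)"
            using \<epsilon> norm_proj_tensor_of_le by (intro mult_left_mono) auto
          then show "\<bar>B a b - g (a \<otimes>\<^sub>\<pi> b)\<bar> \<le> \<epsilon> / 2 * (norm a * norm b)"
            using g(3)[of "a \<otimes>\<^sub>\<pi> b"] f(2) by simp
        qed (use \<epsilon> in simp)
        then show ?thesis
          using norming[OF g(1)] all_1[OF wu g(1,2)] \<epsilon>
          by (intro exI[of _ "\<lambda>a b. g (a \<otimes>\<^sub>\<pi> b)"]) auto
      qed
      then show "\<exists>\<eta>>0. \<forall>B. bounded_bilinear B \<and> bilinear_norm B \<le> 1 \<and> (\<forall>i\<in>?I. B (x i) (y i) > 1 - \<eta>) \<longrightarrow>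
            (\<exists>B'. bounded_bilinear B' \<and> bilinear_norm B' = 1 \<and> (\<forall>i\<in>?I. B' (x i) (y i) = 1) \<and>
                  bilinear_norm (\<lambda>u v. B u v - B' u v) < \<epsilon>)"
        using \<eta>(1) by blast
    qed
  next
    assume A: ?approx
    have "ssd_point (z c)" if c: "weights c" for c
    proof -
      obtain V where V: "bounded_bilinear V" "bilinear_norm V = 1" "\<forall>i\<in>?I. V (x i) (y i) = 1"
        using 1 V by blast
      then obtain f where f: "unit_functional f" "\<And>a b. f (a \<otimes>\<^sub>\<pi> b) = V a b"
        using functional_of_bounded_bilinear[OF V(1)] by auto
      have "1 \<le> norm (z c)"
        using z_1[OF c f(1)] V(3) f(2) unit_functional_le[OF f(1), of "z c"] by simp
      then have nz: "norm (z c) = 1" using norm_z_le[OF c] by simp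
      show ?thesis
        unfolding ssd_point_iff_functionals[OF nz]
      proof (intro allI impI)
        fix \<epsilon> :: real assume \<epsilon>: "0 < \<epsilon>"
        obtain \<eta> where \<eta>: "0 < \<eta>" and near: "\<forall>B.
            bounded_bilinear B \<and> bilinear_norm B \<le> 1 \<and> (\<forall>i\<in>?I. B (x i) (y i) > 1 - \<eta>) \<longrightarrow>
            (\<exists>B'. bounded_bilinear B' \<and> bilinear_norm B' = 1 \<and> (\<forall>i\<in>?I. B' (x i) (y i) = 1) \<and>
                  bilinear_norm (\<lambda>u v. B u v - B' u v) < \<epsilon>)"
          using A \<epsilon> by blast
        \<comment> \<open>A deficit of the average below \<open>m * \<eta>\<close> forces every single deficit below \<open>\<eta>\<close>.\<close>
        define m where "m = Min (c ` ?I)"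
        have m: "0 < m" "\<And>i. i \<in> ?I \<Longrightarrow> m \<le> c i"
          using c assms(1) by (auto simp: m_def weights_def)
        have "\<exists>g. unit_functional g \<and> g (z c) = 1 \<and> (\<forall>w. \<bar>f w - g w\<bar> \<le> \<epsilon> * norm w)"
          if f: "unit_functional f" and gt: "f (z c) > 1 - m * \<eta>" for f
        proof -
          let ?B = "\<lambda>a b. f (a \<otimes>\<^sub>\<pi> b)"
          have "f (x i \<otimes>\<^sub>\<pi> y i) > 1 - \<eta>" if i: "i \<in> ?I" for i
          proof (rule convex_combination_gt[of ?I i c "\<lambda>i. f (x i \<otimes>\<^sub>\<pi> y i)"])
            have "m * \<eta> \<le> c i * \<eta>" using m(2)[OF i] \<eta> by (simp add: mult_right_mono)
            then show "(\<Sum>i\<in>?I. c i * f (x i \<otimes>\<^sub>\<pi> y i)) > 1 - c i * \<eta>"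
              using gt fz[OF f] by simp
          qed (use c i le1[OF f] in \<open>auto simp: weights_def\<close>)
          then obtain B' where B': "bounded_bilinear B'" "bilinear_norm B' = 1"
            "\<forall>i\<in>?I. B' (x i) (y i) = 1" "bilinear_norm (\<lambda>a b. ?B a b - B' a b) < \<epsilon>"
            using near bounded_bilinear_of_functional[OF f] bilinear_norm_of_functional[OF f]
            by blast
          obtain g where g: "unit_functional g" "\<And>a b. g (a \<otimes>\<^sub>\<pi> b) = B' a b"
            using functional_of_bounded_bilinear[OF B'(1)] B'(2) by auto
          have bl: "bounded_linear k" if "unit_functional k"
            for k :: "('a, 'b) proj_tensor \<Rightarrow> real"
            using that by (auto simp: unit_functional_def bounded_linear_def
                bounded_linear_axioms_def intro!: exI[of _ 1])
          have "\<bar>f w - g w\<bar> \<le> \<epsilon> * norm w" for w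
          proof (rule bounded_linear_proj_tensor_bound[OF bounded_linear_sub[OF bl[OF f] bl[OF g(1)]]])
            fix a :: 'a and b :: 'b
            have "\<bar>?B a b - B' a b\<bar> \<le> bilinear_norm (\<lambda>a b. ?B a b - B' a b) * (norm a * norm b)"
              by (rule bilinear_norm_ge)
                (intro bounded_bilinear_diff bounded_bilinear_of_functional f B'(1))
            also have "\<dots> \<le> \<epsilon> * (norm a * norm b)"
              using B'(4) by (intro mult_right_mono) auto
            finally show "\<bar>f (a \<otimes>\<^sub>\<pi> b) - g (a \<otimes>\<^sub>\<pi> b)\<bar> \<le> \<epsilon> * (norm a * norm b)"
              by (simp add: g(2))
          qed (use \<epsilon> in simp)
          then show ?thesis using g z_1[OF c g(1)] B'(3) by auto
        qed
        then show "\<exists>\<eta>>0. \<forall>f. unit_functional f \<and> f (z c) > 1 - \<eta> \<longrightarrow>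
            (\<exists>g. unit_functional g \<and> g (z c) = 1 \<and> (\<forall>w. \<bar>f w - g w\<bar> \<le> \<epsilon> * norm w))"
          using m(1) \<eta> by (intro exI[of _ "m * \<eta>"]) auto
      qed
    qed
    then show ?ssd by (auto simp: z_def weights_def)
  qed
  then show ?thesis using V by blast
qed

end
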